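(* Let $1<p<q$. Let $X$ be an infinite dimensional Banach space with the almost $p$-co-Banach-Saks property, and let $Y$ be a reflexive asymptotically $q$-uniformly smooth Banach space. Then $\alpha_Y(X)\le p/q$. In particular, $X$ does not coarse Lipschitz embed into $Y$.
   Context: $X$ has the almost $p$-co-Banach-Saks property if for every semi-normalized weakly null sequence $(x_n)$ in $X$ there exist a subsequence $(x_{n_j})$ and numbers $\theta_j\in[1,\infty)$ with $\lim_{j\to\infty}j^\alpha\theta_j^{-1}=\infty$ for all $\alpha>0$ and $\|x_{n_{j_1}}+\dots+x_{n_{j_k}}\|\ge k^{1/p}\theta_k^{-1}$ for all $k$ and all $k\le j_1<\dots<j_k$. $Y$ is asymptotically $q$-uniformly smooth if $\overline\rho_Y(t)\le Ct^q$ on $[0,1]$, with $\overline{\rho}_Y(t)=\sup_{y\in\partial B_Y}\inf_{\dim(Y/E)<\infty}\sup_{h\in\partial B_E}\|y+th\|-1$. The compression exponent $\alpha_Y(X)$ is the supremum of $\alpha>0$ for which there exist a coarse embedding $f:X\to Y$ and $L>0$ with $\|f(x)-f(y)\|\ge L^{-1}\|x-y\|^\alpha-L$ for all $x,y$ ($0$ if none); $f$ is a coarse embedding if $\omega_f(t)=\sup\{\|f(x)-f(y)\|:\|x-y\|\le t\}<\infty$ for all $t$ and $\rho_f(t)=\inf\{\|f(x)-f(y)\|:\|x-y\|\ge t\}\to\infty$; a coarse Lipschitz embedding if $\omega_f(t)\le Lt+L$ and $\rho_f(t)\ge L^{-1}t-L$ for some $L>0$. *)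

theory Defs
  imports "HOL-Analysis.Analysis"
begin

definition infinite_dimensional :: "'a::real_normed_vector itself \<Rightarrow> bool" where
  "infinite_dimensional _ \<longleftrightarrow> \<not> (\<exists>S::'a set. finite S \<and> span S = UNIV)"

definition weakly_null :: "(nat \<Rightarrow> 'a::real_normed_vector) \<Rightarrow> bool" where
  "weakly_null x \<longleftrightarrow> (\<forall>f::'a \<Rightarrow> real. bounded_linear f \<longrightarrow> (\<lambda>n. f (x n)) \<longlonglongrightarrow> 0)"

definition semi_normalized :: "(nat \<Rightarrow> 'a::real_normed_vector) \<Rightarrow> bool" where
  "semi_normalized x \<longleftrightarrow> (\<exists>a b. 0 < a \<and> (\<forall>n. a \<le> norm (x n) \<and> norm (x n) \<le> b))"

text \<open>Almost p-co-Banach-Saks property. The subsequence is (x (n j)) for j \<ge> 1;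
  a choice j_1 < ... < j_k with k \<le> j_1 is a finite set J of indices with card J = k
  and k \<le> Min J.\<close>
definition almost_co_BS :: "real \<Rightarrow> 'a::real_normed_vector itself \<Rightarrow> bool" where
  "almost_co_BS p _ \<longleftrightarrow>
    (\<forall>x::nat \<Rightarrow> 'a. semi_normalized x \<and> weakly_null x \<longrightarrow>
      (\<exists>n::nat \<Rightarrow> nat. \<exists>\<theta>::nat \<Rightarrow> real. strict_mono n \<and> (\<forall>j. 1 \<le> \<theta> j) \<and>
         (\<forall>\<alpha>>0. filterlim (\<lambda>j. real j powr \<alpha> / \<theta> j) at_top sequentially) \<and>
         (\<forall>k\<ge>1. \<forall>J. finite J \<and> card J = k \<and> (\<forall>j\<in>J. k \<le> j) \<longrightarrow>
             norm (\<Sum>j\<in>J. x (n j)) \<ge> real k powr (1/p) / \<theta> k)))"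

definition finite_codim :: "'a::real_vector set \<Rightarrow> bool" where
  "finite_codim E \<longleftrightarrow> subspace E \<and> (\<exists>F. finite F \<and> span (E \<union> F) = UNIV)"

text \<open>Modulus of asymptotic uniform smoothness (extended-real valued; sup over the empty
  set is -\<infinity>).\<close>
definition aus_modulus :: "'a::real_normed_vector itself \<Rightarrow> real \<Rightarrow> ereal" where
  "aus_modulus _ t = (SUP y\<in>(sphere (0::'a) 1). INF E\<in>{E. finite_codim E}.
       SUP h\<in>(E \<inter> sphere 0 1). ereal (norm (y + t *\<^sub>R h) - 1))"

definition asymptotically_uniformly_smooth :: "real \<Rightarrow> 'a::real_normed_vector itself \<Rightarrow> bool" where
  "asymptotically_uniformly_smooth q Y \<longleftrightarrow>
     (\<exists>C. \<forall>t\<in>{0..1}. aus_modulus Y t \<le> ereal (C * t powr q))"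

definition reflexive :: "'a::real_normed_vector itself \<Rightarrow> bool" where
  "reflexive _ \<longleftrightarrow> (\<forall>\<Phi> :: ('a \<Rightarrow>\<^sub>L real) \<Rightarrow>\<^sub>L real. \<exists>x::'a. \<forall>g. blinfun_apply \<Phi> g = blinfun_apply g x)"

definition expansion_modulus :: "('a::real_normed_vector \<Rightarrow> 'b::real_normed_vector) \<Rightarrow> real \<Rightarrow> ereal" where
  "expansion_modulus f t = (SUP xy\<in>{(x,y). norm (x - y) \<le> t}. ereal (norm (f (fst xy) - f (snd xy))))"

definition compression_modulus :: "('a::real_normed_vector \<Rightarrow> 'b::real_normed_vector) \<Rightarrow> real \<Rightarrow> ereal" where
  "compression_modulus f t = (INF xy\<in>{(x,y). norm (x - y) \<ge> t}. ereal (norm (f (fst xy) - f (snd xy))))"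

definition coarse_embedding :: "('a::real_normed_vector \<Rightarrow> 'b::real_normed_vector) \<Rightarrow> bool" where
  "coarse_embedding f \<longleftrightarrow> (\<forall>t\<ge>0. expansion_modulus f t < \<infinity>) \<and>
      ((\<lambda>t. compression_modulus f t) \<longlongrightarrow> \<infinity>) at_top"

definition coarse_lipschitz_embedding :: "('a::real_normed_vector \<Rightarrow> 'b::real_normed_vector) \<Rightarrow> bool" where
  "coarse_lipschitz_embedding f \<longleftrightarrow> (\<exists>L>0. \<forall>t\<ge>0.
      expansion_modulus f t \<le> ereal (L * t + L) \<and> compression_modulus f t \<ge> ereal (t / L - L))"

definition compression_exponents ::
    "'a::real_normed_vector itself \<Rightarrow> 'b::real_normed_vector itself \<Rightarrow> real set" where
  "compression_exponents _ _ = {\<alpha>. \<alpha> > 0 \<and> (\<exists>(f::'a \<Rightarrow> 'b) L. coarse_embedding f \<and> L > 0 \<and>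
      (\<forall>x y. norm (f x - f y) \<ge> norm (x - y) powr \<alpha> / L - L))}"

definition compression_exponent ::
    "'b::real_normed_vector itself \<Rightarrow> 'a::real_normed_vector itself \<Rightarrow> ereal" where
  "compression_exponent Y X =
     (if compression_exponents X Y = {} then 0 else Sup (ereal ` compression_exponents X Y))"

end

theory Submission
  imports Defs "HOL-Library.Ramsey" "HOL-Library.Diagonal_Subsequence"
begin

text \<open>
  Let f map X to Y and let (x n) be a bounded sequence in X. Iterated weak limits, along an
  ultrafilter, of \<open>f (x n\<^sub>1 + \<dots> + x n\<^sub>k)\<close> exist because Y is reflexive; the successive differences are
  weakly null and bounded, so asymptotic q-smoothness adds only a constant to the q-th power of the
  norm at each of the k steps. Hence \<open>f (x n\<^sub>1 + \<dots> + x n\<^sub>k)\<close> typically lies within \<open>B k\<^bsup>1/q\<^esup>\<close> of a fixed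
  point (Kalton and Randrianarivony), whereas two such sums can be at distance about \<open>k\<^bsup>1/p\<^esup>\<close> in X.

  The hypothesis on X says nothing when X has no semi-normalized weakly null sequence (for instance
  \<open>\<ell>\<^sub>1\<close>). A separated sequence without weakly Cauchy subsequence is therefore handled by a weak form of
  Rosenthal's \<open>\<ell>\<^sub>1\<close> theorem: for each k, Ramsey's theorem yields a subsequence all of whose alternating
  sums of length 2k have norm at least \<open>k \<delta>\<close>, with \<open>\<delta>\<close> independent of k.
\<close>

section \<open>Ultrafilters and norming functionals\<close>

text \<open>Zorn's lemma for the reversed order. Lower bounds are asked of nonempty chains only,
  since they will be infima of families, which are useful only for nonempty ones; the empty chain is
  bounded by any element of \<open>A\<close>.\<close>

lemma Zorn_minimal:
  fixes A :: "'x::order set"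
  assumes "A \<noteq> {}"
    and "\<And>C. C \<subseteq> A \<Longrightarrow> C \<noteq> {} \<Longrightarrow> (\<And>a b. a \<in> C \<Longrightarrow> b \<in> C \<Longrightarrow> a \<le> b \<or> b \<le> a) \<Longrightarrow> \<exists>u\<in>A. \<forall>a\<in>C. u \<le> a"
  shows "\<exists>m\<in>A. \<forall>a\<in>A. a \<le> m \<longrightarrow> a = m"
proof (rule predicate_Zorn[where P = "\<lambda>a b. b \<le> a", simplified])
  show "partial_order_on A (relation_of (\<lambda>a b. b \<le> a) A)"
    by (rule partial_order_on_relation_ofI) auto
next
  fix C assume C: "C \<in> Chains (relation_of (\<lambda>a b. b \<le> a) A)"
  show "\<exists>u\<in>A. \<forall>a\<in>C. u \<le> a"
  proof (cases "C = {}")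
    case True
    with assms(1) show ?thesis by auto
  next
    case False
    with C show ?thesis
      by (intro assms(2)) (auto simp: Chains_def relation_of_def)
  qed
qed

text \<open>A minimal proper filter below \<open>F\<close> decides every \<open>P\<close>: either
  its restriction to \<open>{n. P n}\<close> is proper, hence equal to it by minimality, or
  \<open>P\<close> fails eventually.\<close>

lemma ultrafilter_below:
  fixes F :: "'i filter"
  assumes "F \<noteq> bot"
  shows "\<exists>U. U \<le> F \<and> U \<noteq> bot \<and> (\<forall>P. eventually P U \<or> eventually (\<lambda>n. \<not> P n) U)"
proof -
  have "\<exists>U\<in>{U. U \<le> F \<and> U \<noteq> bot}. \<forall>a\<in>{U. U \<le> F \<and> U \<noteq> bot}. a \<le> U \<longrightarrow> a = U"
  proof (rule Zorn_minimal)
    show "{U. U \<le> F \<and> U \<noteq> bot} \<noteq> {}" using assms by auto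
  next
    fix C assume C: "C \<subseteq> {U. U \<le> F \<and> U \<noteq> bot}" "C \<noteq> {}"
      and chain: "\<And>a b. a \<in> C \<Longrightarrow> b \<in> C \<Longrightarrow> a \<le> b \<or> b \<le> a"
    \<comment> \<open>For a chain, whatever holds eventually for the infimum already does so for one
      member; hence the infimum stays proper.\<close>
    have ev: "eventually P (Inf C) \<longleftrightarrow> (\<exists>b\<in>C. eventually P b)" for P
    proof (rule eventually_Inf_base)
      show "\<exists>x\<in>C. x \<le> inf F G" if "F \<in> C" "G \<in> C" for F G
        using chain[OF that] that by (metis le_inf_iff order_refl)
    qed (rule C)
    have "Inf C \<noteq> bot"
      using ev[of "\<lambda>_. False"] C by (auto simp: trivial_limit_def)
    moreover have "Inf C \<le> F"
      using C by (auto intro: Inf_lower2)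
    ultimately show "\<exists>u\<in>{U. U \<le> F \<and> U \<noteq> bot}. \<forall>a\<in>C. u \<le> a"
      by (intro bexI[of _ "Inf C"]) (auto intro: Inf_lower)
  qed
  then obtain U where U: "U \<le> F" "U \<noteq> bot"
    and min: "\<And>V. V \<le> F \<Longrightarrow> V \<noteq> bot \<Longrightarrow> V \<le> U \<Longrightarrow> V = U"
    by auto
  have "eventually P U \<or> eventually (\<lambda>n. \<not> P n) U" for P
  proof (cases "inf U (principal {n. P n}) = bot")
    case True
    then have "eventually (\<lambda>n. \<not> P n) U"
      unfolding trivial_limit_def by (simp add: eventually_inf_principal)
    then show ?thesis ..
  next
    case False
    then have "inf U (principal {n. P n}) = U"
      using U by (intro min) (auto intro: le_infI1)
    then have "eventually P U"
      using eventually_inf_principal[of P U "{n. P n}"] by simp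
    then show ?thesis ..
  qed
  with U show ?thesis by blast
qed

text \<open>Compactness of \<open>{-B..B}\<close> gives the image filter a cluster point, and an
  ultrafilter converges to each of its cluster points.\<close>

lemma ultrafilter_bounded_converges:
  fixes f :: "'i \<Rightarrow> real"
  assumes "U \<noteq> bot" and ultra: "\<And>P. eventually P U \<or> eventually (\<lambda>n. \<not> P n) U"
    and bd: "\<And>n. \<bar>f n\<bar> \<le> B"
  shows "\<exists>l. (f \<longlongrightarrow> l) U"
proof -
  have ne: "filtermap f U \<noteq> bot" using assms(1) by (simp add: filtermap_bot_iff)
  have "eventually (\<lambda>y. y \<in> {-B..B}) (filtermap f U)"
    unfolding eventually_filtermap
    by (rule always_eventually) (use bd in \<open>auto simp: abs_le_iff minus_le_iff\<close>)
  with ne obtain l where l: "inf (nhds l) (filtermap f U) \<noteq> bot"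
    using compact_Icc[of "-B" B, unfolded compact_filter] by blast
  have "(f \<longlongrightarrow> l) U"
  proof (rule topological_tendstoI, rule ccontr)
    fix S assume S: "open S" "l \<in> S" and "\<not> eventually (\<lambda>n. f n \<in> S) U"
    with ultra[of "\<lambda>n. f n \<in> S"] have "eventually (\<lambda>n. f n \<notin> S) U" by blast
    then have "eventually (\<lambda>y. y \<notin> S) (filtermap f U)" by (simp add: eventually_filtermap)
    moreover have "eventually (\<lambda>y. y \<in> S) (nhds l)" using S by (rule eventually_nhds_in_open)
    ultimately have "eventually (\<lambda>_. False) (inf (nhds l) (filtermap f U))"
      unfolding eventually_inf by blast
    with l show False by (simp add: trivial_limit_def)
  qed
  then show ?thesis ..
qed

section \<open>Sublinear functionals and the Hahn-Banach argument\<close>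

definition sublinear :: "('a::real_vector \<Rightarrow> real) \<Rightarrow> bool" where
  "sublinear p \<longleftrightarrow> (\<forall>x y. p (x + y) \<le> p x + p y) \<and> (\<forall>c>0. \<forall>x. p (c *\<^sub>R x) \<le> c * p x)"

text \<open>The definition asks for homogeneity only as an inequality, which is easier to check for
  infima; applying it with \<open>1/c\<close> gives the reverse one.\<close>

lemma sublinear_scale:
  assumes "sublinear p" "c > 0"
  shows "p (c *\<^sub>R x) = c * p x"
proof (rule antisym)
  have "p ((1/c) *\<^sub>R (c *\<^sub>R x)) \<le> (1/c) * p (c *\<^sub>R x)"
    using assms unfolding sublinear_def by (meson zero_less_divide_1_iff)
  then show "c * p x \<le> p (c *\<^sub>R x)" using assms(2) by (simp add: field_simps)
qed (use assms in \<open>simp add: sublinear_def\<close>)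

lemma sublinear_zero:
  assumes "sublinear p"
  shows "p 0 = 0"
  using sublinear_scale[OF assms, of 2 0] by simp

lemma sublinear_neg:
  assumes "sublinear p"
  shows "- p (- x) \<le> p x"
proof -
  have "p (x + (- x)) \<le> p x + p (- x)" using assms unfolding sublinear_def by blast
  then show ?thesis using sublinear_zero[OF assms] by simp
qed

text \<open>For sublinear \<open>p\<close> the expression is nonincreasing in \<open>t\<close>, and
  for \<open>t > 0\<close> it equals \<open>t * (p (v + x/t) - p v)\<close>. So this is the
  one-sided directional derivative of \<open>p\<close> at \<open>v\<close> in the direction
  \<open>x\<close>.\<close>

definition slope :: "('a::real_vector \<Rightarrow> real) \<Rightarrow> 'a \<Rightarrow> 'a \<Rightarrow> real" where
  "slope p v x = (INF t\<in>{0..}. p (x + t *\<^sub>R v) - t * p v)"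

lemma slope_bdd_below:
  assumes "sublinear p"
  shows "bdd_below ((\<lambda>t. p (x + t *\<^sub>R v) - t * p v) ` {0..})"
proof (rule bdd_belowI2[where m = "- p (- x)"])
  fix t :: real assume t: "t \<in> {0..}"
  have "p (t *\<^sub>R v) = t * p v"
    using t sublinear_scale[OF assms] sublinear_zero[OF assms] by (cases "t = 0") auto
  moreover have "p ((x + t *\<^sub>R v) + (- x)) \<le> p (x + t *\<^sub>R v) + p (- x)"
    using assms unfolding sublinear_def by blast
  ultimately show "- p (- x) \<le> p (x + t *\<^sub>R v) - t * p v" by simp
qed

lemma slope_le:
  assumes "sublinear p" "t \<ge> 0"
  shows "slope p v x \<le> p (x + t *\<^sub>R v) - t * p v"
  unfolding slope_def by (rule cINF_lower[OF slope_bdd_below[OF assms(1)]]) (use assms(2) in auto)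

text \<open>The infima are compared through their parameters: \<open>t\<close> and \<open>s\<close>
  are matched with \<open>t + s\<close> for subadditivity, and \<open>t\<close> with
  \<open>c * t\<close> for homogeneity.\<close>

lemma sublinear_slope:
  assumes "sublinear p"
  shows "sublinear (slope p v)"
  unfolding sublinear_def
proof (intro conjI allI impI)
  fix x y
  have 1: "slope p v (x + y) \<le> (p (x + t *\<^sub>R v) - t * p v) + (p (y + s *\<^sub>R v) - s * p v)"
    if "t \<ge> 0" "s \<ge> 0" for s t
  proof -
    have "p ((x + t *\<^sub>R v) + (y + s *\<^sub>R v)) \<le> p (x + t *\<^sub>R v) + p (y + s *\<^sub>R v)"
      using assms unfolding sublinear_def by blast
    moreover have "(x + t *\<^sub>R v) + (y + s *\<^sub>R v) = (x + y) + (t + s) *\<^sub>R v"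
      by (simp add: algebra_simps)
    ultimately show ?thesis
      using slope_le[OF assms, of "t + s" v "x + y"] that by (simp add: algebra_simps)
  qed
  have 2: "slope p v (x + y) - (p (y + s *\<^sub>R v) - s * p v) \<le> slope p v x" if "s \<ge> 0" for s
    unfolding slope_def[of p v x] by (rule cINF_greatest) (use 1 that in \<open>auto simp: diff_le_eq\<close>)
  have "slope p v (x + y) - slope p v x \<le> slope p v y"
    unfolding slope_def[of p v y] by (rule cINF_greatest) (use 2 in \<open>auto simp: algebra_simps\<close>)
  then show "slope p v (x + y) \<le> slope p v x + slope p v y" by simp
next
  fix c :: real and x assume c: "c > 0"
  have "slope p v (c *\<^sub>R x) / c \<le> slope p v x"
    unfolding slope_def[of p v x]
  proof (rule cINF_greatest)
    fix t :: real assume t: "t \<in> {0..}"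
    have "slope p v (c *\<^sub>R x) \<le> p (c *\<^sub>R x + (c * t) *\<^sub>R v) - (c * t) * p v"
      using t c by (intro slope_le assms) auto
    also have "c *\<^sub>R x + (c * t) *\<^sub>R v = c *\<^sub>R (x + t *\<^sub>R v)"
      by (simp add: algebra_simps)
    finally show "slope p v (c *\<^sub>R x) / c \<le> p (x + t *\<^sub>R v) - t * p v"
      unfolding sublinear_scale[OF assms c] using c by (simp add: pos_divide_le_eq right_diff_distrib mult.commute mult.left_commute)
  qed auto
  then show "slope p v (c *\<^sub>R x) \<le> c * slope p v x" using c by (simp add: field_simps)
qed

text \<open>A minimal sublinear functional coincides with all its slopes, which makes it additive.\<close>

lemma linear_below_sublinear:
  fixes q :: "'a::real_vector \<Rightarrow> real"
  assumes q: "sublinear q"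
  shows "\<exists>g. linear g \<and> (\<forall>x. g x \<le> q x)"
proof -
  have "\<exists>m\<in>{p. sublinear p \<and> p \<le> q}. \<forall>a\<in>{p. sublinear p \<and> p \<le> q}. a \<le> m \<longrightarrow> a = m"
  proof (rule Zorn_minimal)
    show "{p. sublinear p \<and> p \<le> q} \<noteq> {}" using q by auto
  next
    fix C assume C: "C \<subseteq> {p. sublinear p \<and> p \<le> q}" "C \<noteq> {}"
      and chain: "\<And>a b. a \<in> C \<Longrightarrow> b \<in> C \<Longrightarrow> a \<le> b \<or> b \<le> a"
    define m where "m x = (INF p\<in>C. p x)" for x
    have bdd: "bdd_below ((\<lambda>p. p x) ` C)" for x
    proof (rule bdd_belowI2[where m = "- q (- x)"])
      fix p assume "p \<in> C"
      with C have "sublinear p" "p \<le> q" by auto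
      then show "- q (- x) \<le> p x"
        using sublinear_neg[of p x] by (meson le_funD le_imp_neg_le order_trans)
    qed
    have le: "m x \<le> p x" if "p \<in> C" for p x
      unfolding m_def by (rule cINF_lower[OF bdd that])
    have "sublinear m"
      unfolding sublinear_def
    proof (intro conjI allI impI)
      fix x y
      \<comment> \<open>Of two members of the chain the smaller one bounds both values, and its own
        subadditivity applies.\<close>
      have 1: "m (x + y) \<le> p1 x + p2 y" if p12: "p1 \<in> C" "p2 \<in> C" for p1 p2
      proof -
        have "p1 \<le> p2 \<or> p2 \<le> p1" using p12 by (rule chain)
        then obtain p where p: "p \<in> C" "p \<le> p1" "p \<le> p2"
          using p12 by blast
        then have "p (x + y) \<le> p x + p y" using C unfolding sublinear_def by blast
        then show ?thesis
          using le[OF p(1), of "x + y"] le_funD[OF p(2), of x] le_funD[OF p(3), of y] by linarith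
      qed
      have 2: "m (x + y) - p y \<le> m x" if "p \<in> C" for p
        unfolding m_def[of x] by (rule cINF_greatest) (use C 1 that in \<open>auto simp: diff_le_eq\<close>)
      have "m (x + y) - m x \<le> m y"
        unfolding m_def[of y] by (rule cINF_greatest) (use C 2 in \<open>auto simp: algebra_simps\<close>)
      then show "m (x + y) \<le> m x + m y" by simp
    next
      fix c :: real and x assume c: "c > 0"
      have "m (c *\<^sub>R x) / c \<le> m x"
        unfolding m_def[of x]
      proof (rule cINF_greatest)
        fix p assume p: "p \<in> C"
        with C have "p (c *\<^sub>R x) \<le> c * p x" using c unfolding sublinear_def by blast
        then show "m (c *\<^sub>R x) / c \<le> p x"
          using le[OF p, of "c *\<^sub>R x"] c by (simp add: field_simps)
      qed (rule C)
      then show "m (c *\<^sub>R x) \<le> c * m x" using c by (simp add: field_simps)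
    qed
    moreover have "m \<le> q"
    proof -
      obtain p where "p \<in> C" using C by auto
      moreover from this have "p \<le> q" using C by auto
      ultimately show ?thesis using le by (meson le_funI le_funD order_trans)
    qed
    ultimately show "\<exists>u\<in>{p. sublinear p \<and> p \<le> q}. \<forall>a\<in>C. u \<le> a"
      using le by (intro bexI[of _ m]) (auto intro: le_funI)
  qed
  then obtain m where m: "sublinear m" "m \<le> q"
    and min: "\<And>p. sublinear p \<Longrightarrow> p \<le> q \<Longrightarrow> p \<le> m \<Longrightarrow> p = m"
    by auto
  have slope_eq: "slope m v = m" for v
  proof (rule min)
    show "sublinear (slope m v)" by (rule sublinear_slope[OF m(1)])
    show le: "slope m v \<le> m" using slope_le[OF m(1), of 0] by (auto intro!: le_funI)
    then show "slope m v \<le> q" using m(2) by simp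
  qed
  have add: "m (x + v) = m x + m v" for x v
  proof (rule antisym)
    show "m (x + v) \<le> m x + m v" using m(1) unfolding sublinear_def by blast
    \<comment> \<open>The parameter \<open>1\<close> in the infimum defining the slope gives
      superadditivity.\<close>
    show "m x + m v \<le> m (x + v)"
      using slope_le[OF m(1), of 1 v x] by (simp add: slope_eq)
  qed
  have neg: "m (- x) = - m x" for x
    using add[of x "- x"] sublinear_zero[OF m(1)] by simp
  have "m (c *\<^sub>R x) = c *\<^sub>R m x" for c x
  proof (cases c "0::real" rule: linorder_cases)
    case less
    then show ?thesis
      using sublinear_scale[OF m(1), of "- c" x] neg[of "c *\<^sub>R x"] by simp
  qed (use sublinear_zero[OF m(1)] sublinear_scale[OF m(1)] in auto)
  with add have "linear m" by (rule linearI)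
  with m(2) show ?thesis by (auto simp: le_fun_def)
qed

text \<open>A linear functional below the norm alone could vanish at \<open>u\<close>. Below the
  slope of the norm at \<open>u\<close> it satisfies
  \<open>g (- u) \<le> norm (- u + u) - norm u\<close>, which forces
  \<open>g u = norm u\<close>.\<close>

lemma norming_functional:
  fixes u :: "'a::real_normed_vector"
  shows "\<exists>g::'a \<Rightarrow> real. bounded_linear g \<and> (\<forall>x. \<bar>g x\<bar> \<le> norm x) \<and> g u = norm u"
proof -
  have nrm: "sublinear (norm :: 'a \<Rightarrow> real)"
    by (auto simp: sublinear_def norm_triangle_ineq)
  obtain g where g: "linear g" "\<And>x. g x \<le> slope norm u x"
    using linear_below_sublinear[OF sublinear_slope[OF nrm, of u]] by blast
  have le: "g x \<le> norm x" for x
    using g(2)[of x] slope_le[OF nrm, of 0 u x] by simp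
  have "g (- x) \<le> norm x" for x using le[of "- x"] by simp
  then have abs: "\<bar>g x\<bar> \<le> norm x" for x
    using le[of x] linear_neg[OF g(1), of x] by (metis abs_le_iff)
  have "g (- u) \<le> - norm u"
    using g(2)[of "- u"] slope_le[OF nrm, of 1 u "- u"] by simp
  then have "g u = norm u"
    using le[of u] linear_neg[OF g(1), of u] by simp
  moreover have "bounded_linear g"
    using g(1) abs by (intro bounded_linear_intro[where K = 1]) (auto simp: linear_add linear_scale)
  ultimately show ?thesis using abs by blast
qed

section \<open>Subspaces of finite codimension and weakly null sequences\<close>

text \<open>Dividing by \<open>t\<close> writes \<open>y / t\<close> as \<open>v\<close> minus a
  point of \<open>H\<close>. Thus the coordinate along \<open>v\<close> modulo \<open>H\<close>
  depends continuously on \<open>y\<close>, and is unique (case \<open>y = 0\<close>).\<close>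

lemma coordinate_bound:
  fixes v y :: "'a::real_normed_vector"
  assumes "subspace H" and d: "\<And>h. h \<in> H \<Longrightarrow> d \<le> norm (v - h)" and "y - t *\<^sub>R v \<in> H"
  shows "\<bar>t\<bar> * d \<le> norm y"
proof (cases "t = 0")
  case False
  define h where "h = - ((1/t) *\<^sub>R (y - t *\<^sub>R v))"
  have "h \<in> H" using assms(1,3) unfolding h_def by (simp add: subspace_neg subspace_scale)
  then have "d \<le> norm (v - h)" by (rule d)
  also have "v - h = (1/t) *\<^sub>R y" using False by (simp add: h_def algebra_simps)
  finally show ?thesis using False by (simp add: field_simps)
qed simp

lemma closed_separated:
  fixes v :: "'a::real_normed_vector"
  assumes "closed H" "v \<notin> H"
  shows "\<exists>d>0. \<forall>h\<in>H. d \<le> norm (v - h)"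
proof -
  obtain d where "d > 0" "ball v d \<subseteq> - H"
    using assms open_contains_ball[of "- H"] by (auto simp: closed_def)
  then show ?thesis by (force simp: dist_norm not_le)
qed

lemma span_insert_span: "span (insert v (span S)) = span (insert v S)"
  by (auto simp: span_breakdown_eq span_span)

text \<open>Along a convergent sequence the coordinates at \<open>v\<close> are Cauchy by
  \<open>coordinate_bound\<close>. Their limit splits off, and the remainder converges inside the
  closed \<open>H\<close>.\<close>

lemma closed_span_insert:
  fixes v :: "'a::real_normed_vector"
  assumes "closed H" "subspace H"
  shows "closed (span (insert v H))"
proof (cases "v \<in> H")
  case True
  then have "span (insert v H) = H" by (simp add: insert_absorb span_eq_iff[THEN iffD2, OF assms(2)])
  then show ?thesis using assms(1) by simp
next
  case False
  obtain d where d: "d > 0" "\<And>h. h \<in> H \<Longrightarrow> d \<le> norm (v - h)"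
    using closed_separated[OF assms(1) False] by blast
  have mem: "y \<in> span (insert v H) \<longleftrightarrow> (\<exists>t. y - t *\<^sub>R v \<in> H)" for y
    by (simp add: span_breakdown_eq span_eq_iff[THEN iffD2, OF assms(2)])
  show ?thesis
    unfolding closed_sequential_limits
  proof (intro allI impI)
    fix y l assume "(\<forall>n. y n \<in> span (insert v H)) \<and> y \<longlonglongrightarrow> l"
    then have y: "\<forall>n. \<exists>t. y n - t *\<^sub>R v \<in> H" and lim: "y \<longlonglongrightarrow> l" by (auto simp: mem)
    obtain t where t: "\<And>n. y n - t n *\<^sub>R v \<in> H" using choice[OF y] by blast
    have bound: "\<bar>t m - t n\<bar> * d \<le> norm (y m - y n)" for m n
    proof (rule coordinate_bound[OF assms(2) d(2)])
      have "(y m - t m *\<^sub>R v) - (y n - t n *\<^sub>R v) \<in> H"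
        by (rule subspace_diff[OF assms(2) t t])
      then show "y m - y n - (t m - t n) *\<^sub>R v \<in> H" by (simp add: algebra_simps)
    qed
    have "Cauchy t"
    proof (rule CauchyI)
      fix e :: real assume "e > 0"
      then have "e * d > 0" using d(1) by simp
      with LIMSEQ_imp_Cauchy[OF lim] obtain M where M: "\<And>m n. m \<ge> M \<Longrightarrow> n \<ge> M \<Longrightarrow> norm (y m - y n) < e * d"
        unfolding Cauchy_iff by blast
      have "norm (t m - t n) < e" if "m \<ge> M" "n \<ge> M" for m n
        using bound[of m n] M[OF that] d(1) by (metis mult_less_cancel_right_pos order_le_less_trans real_norm_def)
      then show "\<exists>M. \<forall>m\<ge>M. \<forall>n\<ge>M. norm (t m - t n) < e" by blast
    qed
    then obtain s where "t \<longlonglongrightarrow> s" using Cauchy_convergent_iff convergent_def by blast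
    then have "(\<lambda>n. y n - t n *\<^sub>R v) \<longlonglongrightarrow> l - s *\<^sub>R v" by (intro tendsto_intros lim)
    with assms(1) t have "l - s *\<^sub>R v \<in> H"
      using closed_sequentially[of H "\<lambda>n. y n - t n *\<^sub>R v"] by blast
    then show "l \<in> span (insert v H)" by (auto simp: mem)
  qed
qed

lemma closed_span_Un_finite:
  fixes E :: "'a::real_normed_vector set"
  assumes "finite F" "closed E" "subspace E"
  shows "closed (span (E \<union> F))"
  using assms(1)
proof (induction F)
  case empty
  then show ?case using assms by (simp add: span_eq_iff[THEN iffD2, OF assms(3)])
next
  case (insert v F)
  have "span (E \<union> insert v F) = span (insert v (span (E \<union> F)))"
    by (simp add: span_insert_span)
  then show ?case using closed_span_insert[OF insert.IH] by simp
qed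

lemma closed_span_finite:
  fixes F :: "'a::real_normed_vector set"
  assumes "finite F"
  shows "closed (span F)"
  using closed_span_Un_finite[OF assms, of "{0}"] by (simp add: subspace_0 subspace_def)

text \<open>Riesz's lemma: take \<open>h0\<close> in \<open>H\<close> whose distance to
  \<open>v\<close> is less than twice the infimum, and normalize \<open>v - h0\<close>.\<close>

lemma Riesz_half:
  fixes H :: "'a::real_normed_vector set"
  assumes "closed H" "subspace H" "v \<notin> H"
  shows "\<exists>x. norm x = 1 \<and> (\<forall>h\<in>H. 1/2 \<le> norm (x - h))"
proof -
  have ne: "H \<noteq> {}" using assms(2) subspace_0 by blast
  define d where "d = infdist v H"
  have d: "d > 0" using infdist_pos_not_in_closed[OF assms(1) ne assms(3)] by (simp add: d_def)
  have "(INF a\<in>H. dist v a) < 2 * d" using d ne by (simp add: d_def infdist_notempty)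
  then obtain h0 where h0: "h0 \<in> H" "dist v h0 < 2 * d"
    using cINF_less_iff[OF ne bdd_belowI2[of H 0 "dist v"]] by auto
  define r where "r = norm (v - h0)"
  have r: "r > 0" "r < 2 * d" using h0 assms(3) by (auto simp: r_def dist_norm)
  have "1/2 \<le> norm ((1/r) *\<^sub>R (v - h0) - h)" if "h \<in> H" for h
  proof -
    have "h0 + r *\<^sub>R h \<in> H" using h0(1) that assms(2) by (intro subspace_add subspace_scale)
    then have "d \<le> norm (v - (h0 + r *\<^sub>R h))" unfolding d_def by (metis dist_norm infdist_le)
    also have "v - (h0 + r *\<^sub>R h) = r *\<^sub>R ((1/r) *\<^sub>R (v - h0) - h)"
      using r by (simp add: algebra_simps)
    also have "norm \<dots> = r * norm ((1/r) *\<^sub>R (v - h0) - h)" using r by simp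
    finally have "r * (1/2) \<le> r * norm ((1/r) *\<^sub>R (v - h0) - h)" using r(2) by linarith
    then show ?thesis using r by (simp only: mult_le_cancel_left_pos)
  qed
  moreover have "norm ((1/r) *\<^sub>R (v - h0)) = 1" using r by (simp add: r_def)
  ultimately show ?thesis by blast
qed

text \<open>Each new term is a Riesz vector for the span of the earlier ones, a closed proper
  subspace.\<close>

lemma separated_sequence:
  assumes "infinite_dimensional TYPE('a::real_normed_vector)"
  shows "\<exists>x::nat \<Rightarrow> 'a. (\<forall>n. norm (x n) = 1) \<and> (\<forall>m n. m \<noteq> n \<longrightarrow> 1/2 \<le> norm (x m - x n))"
proof -
  have "\<exists>x::nat \<Rightarrow> 'a. \<forall>n. norm (x n) = 1 \<and> (\<forall>m<n. 1/2 \<le> norm (x n - x m))"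
  proof (rule dependent_wellorder_choice)
    fix x :: "nat \<Rightarrow> 'a" and n :: nat
    have fin: "finite (x ` {..<n})" by simp
    with assms obtain v where "v \<notin> span (x ` {..<n})"
      unfolding infinite_dimensional_def by blast
    then obtain r where r: "norm r = 1" "\<forall>h\<in>span (x ` {..<n}). 1/2 \<le> norm (r - h)"
      using Riesz_half[OF closed_span_finite[OF fin] subspace_span] by blast
    have "1/2 \<le> norm (r - x m)" if "m < n" for m
      using that by (intro r(2)[rule_format] span_base) auto
    with r(1) show "\<exists>r. norm r = 1 \<and> (\<forall>m<n. 1/2 \<le> norm (r - x m))" by blast
  qed auto
  then obtain x :: "nat \<Rightarrow> 'a" where x: "\<And>n. norm (x n) = 1" "\<And>m n. m < n \<Longrightarrow> 1/2 \<le> norm (x n - x m)"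
    by blast
  have "1/2 \<le> norm (x m - x n)" if "m \<noteq> n" for m n
    using x(2)[of m n] x(2)[of n m] that by (cases "m < n") (auto simp: norm_minus_commute)
  with x(1) show ?thesis by blast
qed

definition weakly_null_along :: "'i filter \<Rightarrow> ('i \<Rightarrow> 'a::real_normed_vector) \<Rightarrow> bool" where
  "weakly_null_along U z \<longleftrightarrow> (\<forall>f::'a \<Rightarrow> real. bounded_linear f \<longrightarrow> ((\<lambda>n. f (z n)) \<longlongrightarrow> 0) U)"

text \<open>Formulated with an operator R so that the coordinate functionals of the induction are defined on the
  whole space and no extension theorem is needed.\<close>

lemma finite_codim_almost_projection:
  fixes G :: "'a::real_normed_vector set" and R :: "'a \<Rightarrow> 'a"
  assumes "finite F" "closed G" "subspace G" "bounded_linear R" "range R \<subseteq> span (G \<union> F)"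
  shows "\<exists>P. range P \<subseteq> G \<and>
    (\<forall>(U::'i filter) w. weakly_null_along U w \<longrightarrow> ((\<lambda>n. R (w n) - P (w n)) \<longlongrightarrow> 0) U)"
  using assms(1,4,5)
proof (induction F arbitrary: R)
  case empty
  then have "range R \<subseteq> G" by (simp add: span_eq_iff[THEN iffD2, OF assms(3)])
  then show ?case by (intro exI[of _ R]) auto
next
  case (insert v F)
  define H where "H = span (G \<union> F)"
  have H: "subspace H" "closed H"
    using closed_span_Un_finite insert assms by (auto simp: H_def)
  have R: "\<exists>t. R y - t *\<^sub>R v \<in> H" for y
    using insert.prems(2) span_breakdown_eq[of "R y" v "G \<union> F"] by (auto simp: H_def)
  show ?case
  proof (cases "v \<in> H")
    case True
    have "range R \<subseteq> H"
    proof (intro subsetI, elim rangeE)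
      fix x y assume "x = R y"
      moreover obtain t where "R y - t *\<^sub>R v \<in> H" using R by blast
      then have "(R y - t *\<^sub>R v) + t *\<^sub>R v \<in> H"
        using True H(1) by (intro subspace_add subspace_scale)
      ultimately show "x \<in> H" by simp
    qed
    then show ?thesis using insert.IH[OF insert.prems(1)] by (simp add: H_def)
  next
    case False
    obtain d where d: "d > 0" "\<And>h. h \<in> H \<Longrightarrow> d \<le> norm (v - h)"
      using closed_separated[OF H(2) False] by blast
    \<comment> \<open>\<open>g y\<close> is the coordinate of \<open>R y\<close> along
      \<open>v\<close> modulo \<open>H\<close>. Uniqueness makes it linear,
      \<open>coordinate_bound\<close> makes it bounded.\<close>
    obtain g where g: "\<And>y. R y - g y *\<^sub>R v \<in> H" using choice[of "\<lambda>y t. R y - t *\<^sub>R v \<in> H"] R by blast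
    have g_eq: "g y = t" if "R y - t *\<^sub>R v \<in> H" for y t
    proof -
      have "(R y - g y *\<^sub>R v) - (R y - t *\<^sub>R v) \<in> H" by (rule subspace_diff[OF H(1) g that])
      then have "0 - (g y - t) *\<^sub>R v \<in> H" by (simp add: algebra_simps)
      from coordinate_bound[OF H(1) d(2) this] d(1) show ?thesis by (simp add: mult_le_0_iff)
    qed
    interpret R: bounded_linear R by (rule insert.prems(1))
    have "g (x + y) = g x + g y" for x y
    proof (rule g_eq)
      have "(R x - g x *\<^sub>R v) + (R y - g y *\<^sub>R v) \<in> H" using g H(1) by (intro subspace_add)
      then show "R (x + y) - (g x + g y) *\<^sub>R v \<in> H" by (simp add: algebra_simps R.add)
    qed
    moreover have "g (c *\<^sub>R x) = c *\<^sub>R g x" for c x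
    proof (rule g_eq)
      have "c *\<^sub>R (R x - g x *\<^sub>R v) \<in> H" using g H(1) by (intro subspace_scale)
      then show "R (c *\<^sub>R x) - (c *\<^sub>R g x) *\<^sub>R v \<in> H" by (simp add: algebra_simps R.scaleR)
    qed
    moreover obtain K where K: "\<And>y. norm (R y) \<le> norm y * K" using R.bounded by blast
    moreover have "norm (g y) \<le> norm y * (K / d)" for y
    proof -
      have "\<bar>g y\<bar> * d \<le> norm (R y)" by (rule coordinate_bound[OF H(1) d(2) g])
      with K[of y] show ?thesis using d(1) by (simp add: field_simps)
    qed
    ultimately have blg: "bounded_linear g" by (rule_tac bounded_linear_intro)
    \<comment> \<open>Removing the \<open>v\<close> component leaves an operator into the smaller
      span. The removed part tends to 0 along weakly null families because \<open>g\<close> is a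
      bounded functional.\<close>
    have "bounded_linear (\<lambda>y. R y - g y *\<^sub>R v)"
      using blg insert.prems(1)
      by (intro bounded_linear_sub bounded_linear_compose[OF bounded_linear_scaleR_left])
    moreover have "range (\<lambda>y. R y - g y *\<^sub>R v) \<subseteq> span (G \<union> F)" using g by (auto simp: H_def)
    ultimately obtain P where P: "range P \<subseteq> G"
      "\<And>(U::'i filter) w. weakly_null_along U w \<Longrightarrow> ((\<lambda>n. R (w n) - g (w n) *\<^sub>R v - P (w n)) \<longlongrightarrow> 0) U"
      using insert.IH[of "\<lambda>y. R y - g y *\<^sub>R v"] by blast
    have "((\<lambda>n. R (w n) - P (w n)) \<longlongrightarrow> 0) U" if w: "weakly_null_along U w" for U :: "'i filter" and w
    proof -
      have "((\<lambda>n. g (w n)) \<longlongrightarrow> 0) U" using w blg by (simp add: weakly_null_along_def)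
      then have "((\<lambda>n. (R (w n) - g (w n) *\<^sub>R v - P (w n)) + g (w n) *\<^sub>R v) \<longlongrightarrow> 0 + 0 *\<^sub>R v) U"
        by (intro tendsto_intros P(2) w)
      then show ?thesis by (simp add: algebra_simps)
    qed
    with P(1) show ?thesis by blast
  qed
qed

lemma subspace_closure:
  fixes E :: "'a::real_normed_vector set"
  assumes "subspace E"
  shows "subspace (closure E)"
  unfolding subspace_def
proof (intro conjI ballI allI)
  show "0 \<in> closure E" using subspace_0[OF assms] closure_subset by blast
next
  fix x y assume "x \<in> closure E" "y \<in> closure E"
  then obtain f g where "\<And>n. f n \<in> E" "f \<longlonglongrightarrow> x" "\<And>n. g n \<in> E" "g \<longlonglongrightarrow> y"
    unfolding closure_sequential by blast
  then have "(\<forall>n. f n + g n \<in> E) \<and> (\<lambda>n. f n + g n) \<longlonglongrightarrow> x + y"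
    using assms by (auto intro: subspace_add tendsto_add)
  then show "x + y \<in> closure E" unfolding closure_sequential by (rule exI[of _ "\<lambda>n. f n + g n"])
next
  fix c x assume "x \<in> closure E"
  then obtain f where "\<And>n. f n \<in> E" "f \<longlonglongrightarrow> x" unfolding closure_sequential by blast
  then have "(\<forall>n. c *\<^sub>R f n \<in> E) \<and> (\<lambda>n. c *\<^sub>R f n) \<longlonglongrightarrow> c *\<^sub>R x"
    using assms by (auto intro: subspace_scale tendsto_scaleR)
  then show "c *\<^sub>R x \<in> closure E" unfolding closure_sequential by (rule exI[of _ "\<lambda>n. c *\<^sub>R f n"])
qed

text \<open>E need not be closed, so the almost projection is taken onto its closure.\<close>

lemma weakly_null_near_finite_codim:
  fixes E :: "'a::real_normed_vector set" and U :: "'i filter"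
  assumes "finite_codim E" "weakly_null_along U z" "\<tau> > 0"
  shows "eventually (\<lambda>n. \<exists>e\<in>E. norm (z n - e) < \<tau>) U"
proof -
  obtain F where E: "subspace E" and F: "finite F" "span (E \<union> F) = UNIV"
    using assms(1) by (auto simp: finite_codim_def)
  have "subspace (closure E)" using E by (rule subspace_closure)
  moreover have "span (closure E \<union> F) = UNIV"
    using F(2) span_mono[of "E \<union> F" "closure E \<union> F"] closure_subset by blast
  ultimately obtain P where P: "range P \<subseteq> closure E" "((\<lambda>n. z n - P (z n)) \<longlongrightarrow> 0) U"
    using finite_codim_almost_projection[where 'i = 'i, OF F(1) closed_closure[of E], of "\<lambda>x. x"] assms(2)
    by auto
  have "eventually (\<lambda>n. norm (z n - P (z n)) < \<tau> / 2) U"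
    using tendstoD[OF P(2), of "\<tau> / 2"] assms(3) by simp
  then show ?thesis
  proof (rule eventually_mono)
    fix n assume n: "norm (z n - P (z n)) < \<tau> / 2"
    have "P (z n) \<in> closure E" using P(1) by auto
    then obtain e where "e \<in> E" "dist e (P (z n)) < \<tau> / 2"
      using assms(3) by (meson closure_approachable half_gt_zero)
    moreover have "norm (z n - e) \<le> norm (z n - P (z n)) + norm (P (z n) - e)"
      using norm_triangle_ineq[of "z n - P (z n)" "P (z n) - e"] by simp
    ultimately show "\<exists>e\<in>E. norm (z n - e) < \<tau>"
      using n by (intro bexI[of _ e]) (auto simp: dist_norm norm_minus_commute)
  qed
qed

section \<open>Concentration in asymptotically uniformly smooth spaces\<close>

text \<open>Convexity of the power on the segment from \<open>1\<close> to \<open>1 + c\<close>.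
  With \<open>l = t powr q\<close> it turns a bound on a norm into one on its \<open>q\<close>-th
  power that is linear in \<open>t powr q\<close>.\<close>

lemma powr_convex_bound:
  fixes c l q :: real
  assumes "q \<ge> 1" "c \<ge> 0" "0 \<le> l" "l \<le> 1"
  shows "(1 + l * c) powr q \<le> 1 + l * (1 + c) powr q"
proof -
  have "((1 - l) *\<^sub>R 1 + l *\<^sub>R (1 + c)) powr q \<le> (1 - l) * 1 powr q + l * (1 + c) powr q"
    using assms by (intro convex_onD[OF powr_convex]) auto
  also have "(1 - l) *\<^sub>R 1 + l *\<^sub>R (1 + c) = 1 + l * c" by (simp add: algebra_simps)
  finally show ?thesis using assms by simp
qed

text \<open>The gap between \<open>c\<close> and \<open>c'\<close> pays for the infimum over
  \<open>E\<close>, which may not be attained.\<close>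

lemma aus_modulus_subspace:
  fixes y :: "'b::real_normed_vector"
  assumes "aus_modulus TYPE('b) t \<le> ereal c" "c < c'" "norm y = 1"
  shows "\<exists>E. finite_codim E \<and> (\<forall>h\<in>E. norm h = 1 \<longrightarrow> norm (y + t *\<^sub>R h) \<le> 1 + c')"
proof -
  have "(INF E\<in>{E. finite_codim E}. SUP h\<in>(E \<inter> sphere 0 1). ereal (norm (y + t *\<^sub>R h) - 1))
      \<le> aus_modulus TYPE('b) t"
    unfolding aus_modulus_def by (rule SUP_upper) (use assms(3) in simp)
  also have "\<dots> < ereal c'" using assms(1,2) by (simp add: order_le_less_trans)
  finally obtain E :: "'b set" where E: "finite_codim E"
    and lt: "(SUP h\<in>(E \<inter> sphere 0 1). ereal (norm (y + t *\<^sub>R h) - 1)) < ereal c'"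
    unfolding INF_less_iff by blast
  have "norm (y + t *\<^sub>R h) \<le> 1 + c'" if "h \<in> E" "norm h = 1" for h
  proof -
    have "ereal (norm (y + t *\<^sub>R h) - 1) < ereal c'"
      using lt by (rule SUP_lessD) (use that in simp)
    then show ?thesis by simp
  qed
  with E show ?thesis by blast
qed

text \<open>The subspace supplied by the modulus depends on t; by convexity it also works for all smaller t, so it
  handles every perturbation of norm at most D.\<close>

lemma aus_weakly_null_step:
  assumes aus: "asymptotically_uniformly_smooth q TYPE('b::real_normed_vector)" and q: "q \<ge> 1"
  shows "\<exists>K>0. \<forall>(U::'i filter) (z::'i \<Rightarrow> 'b) x D. D > 0 \<longrightarrow> weakly_null_along U z \<longrightarrow> (\<forall>n. norm (z n) \<le> D) \<longrightarrow>
    eventually (\<lambda>n. norm (x + z n) powr q \<le> norm x powr q + K * D powr q) U"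
proof -
  obtain C0 where C0: "\<And>t. t \<in> {0..1} \<Longrightarrow> aus_modulus TYPE('b) t \<le> ereal (C0 * t powr q)"
    using aus unfolding asymptotically_uniformly_smooth_def by blast
  define C where "C = max C0 0"
  \<comment> \<open>Two cases meet here: if \<open>norm x \<le> D\<close>, the sum has norm at most
    \<open>2 * D\<close>; otherwise the normalized norm is at most
    \<open>1 + (C + 2) * t powr q\<close>, and \<open>powr_convex_bound\<close> yields
    \<open>(C + 3) powr q\<close>.\<close>
  define K where "K = (C + 3) powr q"
  have "eventually (\<lambda>n. norm (x + z n) powr q \<le> norm x powr q + K * D powr q) U"
    if D: "D > 0" and z: "weakly_null_along U z" "\<And>n. norm (z n) \<le> D"
    for U :: "'i filter" and z :: "'i \<Rightarrow> 'b" and x D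
  proof (cases "norm x \<le> D")
    case True
    have "norm (x + z n) powr q \<le> norm x powr q + K * D powr q" for n
    proof -
      have "norm (x + z n) \<le> (C + 3) * D"
      proof -
        have "norm (x + z n) \<le> norm x + norm (z n)" by (rule norm_triangle_ineq)
        also have "\<dots> \<le> 2 * D" using True z(2)[of n] by simp
        also have "\<dots> \<le> (C + 3) * D" using D by (intro mult_right_mono) (auto simp: C_def)
        finally show ?thesis .
      qed
      then have "norm (x + z n) powr q \<le> ((C + 3) * D) powr q"
        using q by (intro powr_mono2) auto
      also have "\<dots> = K * D powr q" using D by (simp add: K_def C_def powr_mult)
      finally show ?thesis by (simp add: add_increasing)
    qed
    then show ?thesis by simp
  next
    case False
    define r where "r = norm x"
    \<comment> \<open>After division by \<open>r = norm x\<close>, every perturbation has norm at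
      most \<open>t\<close>, and \<open>t < 1\<close>.\<close>
    define t where "t = D / r"
    define y where "y = (1 / r) *\<^sub>R x"
    have r: "r > 0" "D < r" using False D by (auto simp: r_def)
    have t: "0 < t" "t \<le> 1" using r D by (auto simp: t_def)
    have tq: "0 < t powr q" "t powr q \<le> 1" using t q powr_mono2[of q t 1] by auto
    have "norm y = 1" using r by (simp add: y_def r_def)
    moreover have "C0 * t powr q < (C + 1) * t powr q"
      using tq(1) by (intro mult_strict_right_mono) (auto simp: C_def)
    ultimately obtain E where E: "finite_codim E"
      and Eb: "\<And>h. h \<in> E \<Longrightarrow> norm h = 1 \<Longrightarrow> norm (y + t *\<^sub>R h) \<le> 1 + (C + 1) * t powr q"
      using aus_modulus_subspace[OF C0] t by (metis atLeastAtMost_iff less_imp_le)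
    have sub: "subspace E" using E by (simp add: finite_codim_def)
    have Eball: "norm (y + e) \<le> 1 + (C + 1) * t powr q" if e: "e \<in> E" "norm e \<le> t" for e
    proof (cases "e = 0")
      case True
      have "0 \<le> (C + 1) * t powr q" by (simp add: C_def)
      with True \<open>norm y = 1\<close> show ?thesis by simp
    next
      case False
      define l where "l = norm e / t"
      define h where "h = (1 / norm e) *\<^sub>R e"
      have l: "0 \<le> l" "l \<le> 1" using e(2) t by (auto simp: l_def)
      have h: "h \<in> E" "norm h = 1" using e(1) sub False by (auto simp: h_def subspace_scale)
      have "e = l *\<^sub>R (t *\<^sub>R h)" using False t by (simp add: l_def h_def)
      then have "y + e = (1 - l) *\<^sub>R y + l *\<^sub>R (y + t *\<^sub>R h)" by (simp add: algebra_simps)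
      then have "norm (y + e) \<le> norm ((1 - l) *\<^sub>R y) + norm (l *\<^sub>R (y + t *\<^sub>R h))"
        by (metis norm_triangle_ineq)
      also have "\<dots> \<le> (1 - l) * 1 + l * (1 + (C + 1) * t powr q)"
        using l Eb[OF h] \<open>norm y = 1\<close> by (simp add: mult_left_mono)
      also have "\<dots> = 1 + l * ((C + 1) * t powr q)" by (simp add: algebra_simps)
      also have "\<dots> \<le> 1 + 1 * ((C + 1) * t powr q)"
        using l by (intro add_left_mono mult_right_mono) (auto simp: C_def)
      finally show ?thesis by simp
    qed
    \<comment> \<open>Two approximations follow, each costing at most \<open>\<tau>\<close>.
      Together they cost \<open>t powr q\<close>, which raises the factor \<open>C + 1\<close> to
      \<open>C + 2\<close>.\<close>
    define \<tau> where "\<tau> = t powr q / 2"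
    have \<tau>: "\<tau> > 0" using tq by (simp add: \<tau>_def)
    have near: "eventually (\<lambda>n. \<exists>e\<in>E. norm (z n - e) < r * \<tau>) U"
      using r \<tau> by (intro weakly_null_near_finite_codim[OF E z(1)]) simp
    then show ?thesis
    proof (rule eventually_mono)
      fix n assume "\<exists>e\<in>E. norm (z n - e) < r * \<tau>"
      then obtain e' where e': "e' \<in> E" "norm (z n - e') < r * \<tau>" by blast
      define w where "w = (1 / r) *\<^sub>R z n"
      define e where "e = (1 / r) *\<^sub>R e'"
      have w: "norm w \<le> t" using z(2)[of n] r by (simp add: w_def t_def divide_right_mono)
      have eE: "e \<in> E" using e'(1) sub by (simp add: e_def subspace_scale)
      have "w - e = (1 / r) *\<^sub>R (z n - e')" by (simp add: w_def e_def algebra_simps)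
      then have "norm (w - e) = norm (z n - e') / r" using r by simp
      then have we: "norm (w - e) < \<tau>" using e'(2) r by (simp add: pos_divide_less_eq mult.commute)
      have ne: "norm e \<le> t + \<tau>"
        using w we norm_triangle_ineq2[of e w] norm_minus_commute[of e w] by linarith
      \<comment> \<open>The approximant \<open>e\<close> may be longer than \<open>t\<close> by
        \<open>\<tau>\<close>; this scaling brings it back into the ball where \<open>Eball\<close>
        applies and moves it by at most \<open>\<tau>\<close>.\<close>
      define f where "f = (t / (t + \<tau>)) *\<^sub>R e"
      have fE: "f \<in> E" using eE sub by (simp add: f_def subspace_scale)
      have "norm f = t * (norm e / (t + \<tau>))" using t \<tau> by (simp add: f_def)
      also have "\<dots> \<le> t * 1" using ne t \<tau> by (intro mult_left_mono) auto
      finally have nf: "norm f \<le> t" by simp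
      have "e - f = (\<tau> / (t + \<tau>)) *\<^sub>R e"
      proof -
        have "1 - t / (t + \<tau>) = \<tau> / (t + \<tau>)" using t \<tau> by (simp add: field_simps)
        then show ?thesis unfolding f_def by (metis scaleR_left_diff_distrib scaleR_one)
      qed
      then have "norm (e - f) = \<tau> * (norm e / (t + \<tau>))" using t \<tau> by simp
      also have "\<dots> \<le> \<tau> * 1" using ne t \<tau> by (intro mult_left_mono) auto
      finally have ef: "norm (e - f) \<le> \<tau>" by simp
      have "norm (y + w) \<le> norm (y + f) + norm (w - e) + norm (e - f)"
        using norm_triangle_ineq[of "y + f" "(w - e) + (e - f)"] norm_triangle_ineq[of "w - e" "e - f"]
        by (simp add: algebra_simps)
      also have "\<dots> \<le> 1 + (C + 1) * t powr q + \<tau> + \<tau>"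
        using Eball[OF fE nf] we ef by linarith
      also have "\<dots> = 1 + t powr q * (C + 2)" by (simp add: \<tau>_def algebra_simps)
      finally have "norm (y + w) powr q \<le> (1 + t powr q * (C + 2)) powr q"
        using q by (intro powr_mono2) auto
      also have "\<dots> \<le> 1 + t powr q * (1 + (C + 2)) powr q"
        using q tq by (intro powr_convex_bound) (auto simp: C_def)
      also have "\<dots> = 1 + t powr q * K" by (simp add: K_def add.commute)
      finally have yw: "norm (y + w) powr q \<le> 1 + t powr q * K" .
      have "x + z n = r *\<^sub>R (y + w)" using r by (simp add: y_def w_def algebra_simps)
      then have "norm (x + z n) powr q = r powr q * norm (y + w) powr q"
        using r by (simp add: powr_mult)
      also have "\<dots> \<le> r powr q * (1 + t powr q * K)" using yw by (intro mult_left_mono) auto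
      also have "\<dots> = r powr q + K * (r * t) powr q" using r t by (simp add: powr_mult algebra_simps)
      also have "r * t = D" using r by (simp add: t_def)
      finally show "norm (x + z n) powr q \<le> norm x powr q + K * D powr q" by (simp add: r_def)
    qed
  qed
  moreover have "K > 0" by (simp add: K_def C_def)
  ultimately show ?thesis by blast
qed

section \<open>Weak limits along ultrafilters in reflexive spaces\<close>

definition weak_limit :: "'i filter \<Rightarrow> ('i \<Rightarrow> 'a::real_normed_vector) \<Rightarrow> 'a \<Rightarrow> bool" where
  "weak_limit U y v \<longleftrightarrow> (\<forall>f::'a \<Rightarrow> real. bounded_linear f \<longrightarrow> ((\<lambda>n. f (y n)) \<longlongrightarrow> f v) U)"

lemma weak_limit_diff:
  assumes "weak_limit U y v" "weak_limit U z w"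
  shows "weak_limit U (\<lambda>n. y n - z n) (v - w)"
  using assms unfolding weak_limit_def by (auto simp: bounded_linear.axioms linear_diff bounded_linear.linear intro: tendsto_diff)

lemma weak_limit_const: "weak_limit U (\<lambda>_. c) c"
  by (simp add: weak_limit_def)

text \<open>Weak lower semicontinuity of the norm, tested on a norming functional of the
  limit.\<close>

lemma weak_limit_norm_le:
  assumes "weak_limit U y v" "U \<noteq> bot" "\<And>n. norm (y n) \<le> D"
  shows "norm v \<le> D"
proof -
  obtain g where g: "bounded_linear g" "\<And>x. \<bar>g x\<bar> \<le> norm x" "g v = norm v"
    using norming_functional[of v] by blast
  have "((\<lambda>n. g (y n)) \<longlongrightarrow> g v) U" using assms(1) g(1) by (simp add: weak_limit_def)
  moreover have "g (y n) \<le> D" for n using g(2)[of "y n"] assms(3)[of n] by linarith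
  ultimately have "g v \<le> D" using tendsto_upperbound[OF _ always_eventually assms(2)] by blast
  with g(3) show ?thesis by simp
qed

text \<open>The limits of \<open>g (y n)\<close> along \<open>U\<close> form a bounded functional of
  \<open>g\<close>; reflexivity represents it by a point.\<close>

lemma reflexive_weak_limit:
  fixes y :: "'i \<Rightarrow> 'b::real_normed_vector"
  assumes refl: "reflexive TYPE('b)" and U: "U \<noteq> bot"
    and ultra: "\<And>P. eventually P U \<or> eventually (\<lambda>n. \<not> P n) U"
    and bd: "\<And>n. norm (y n) \<le> B"
  shows "\<exists>v. weak_limit U y v"
proof -
  have "\<exists>l. ((\<lambda>n. blinfun_apply g (y n)) \<longlongrightarrow> l) U" for g :: "'b \<Rightarrow>\<^sub>L real"
  proof (rule ultrafilter_bounded_converges[OF U ultra])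
    fix n
    have "norm (blinfun_apply g (y n)) \<le> norm g * norm (y n)" by (rule norm_blinfun)
    also have "\<dots> \<le> norm g * B" using bd by (simp add: mult_left_mono)
    finally show "\<bar>blinfun_apply g (y n)\<bar> \<le> norm g * B" by simp
  qed
  then obtain \<Phi> where \<Phi>: "\<And>g :: 'b \<Rightarrow>\<^sub>L real. ((\<lambda>n. blinfun_apply g (y n)) \<longlongrightarrow> \<Phi> g) U"
    using choice[of "\<lambda>(g::'b \<Rightarrow>\<^sub>L real) l. ((\<lambda>n. blinfun_apply g (y n)) \<longlongrightarrow> l) U"] by blast
  have "bounded_linear \<Phi>"
  proof (rule bounded_linear_intro)
    fix g h :: "'b \<Rightarrow>\<^sub>L real"
    have "((\<lambda>n. blinfun_apply (g + h) (y n)) \<longlongrightarrow> \<Phi> g + \<Phi> h) U"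
      using tendsto_add[OF \<Phi> \<Phi>] by (simp add: blinfun.add_left)
    with U \<Phi> show "\<Phi> (g + h) = \<Phi> g + \<Phi> h" using tendsto_unique by blast
  next
    fix c and g :: "'b \<Rightarrow>\<^sub>L real"
    have "((\<lambda>n. blinfun_apply (c *\<^sub>R g) (y n)) \<longlongrightarrow> c *\<^sub>R \<Phi> g) U"
      using tendsto_scaleR[OF tendsto_const \<Phi>] by (simp add: blinfun.scaleR_left)
    with U \<Phi> show "\<Phi> (c *\<^sub>R g) = c *\<^sub>R \<Phi> g" using tendsto_unique by blast
  next
    fix g :: "'b \<Rightarrow>\<^sub>L real"
    have "((\<lambda>n. norm (blinfun_apply g (y n))) \<longlongrightarrow> norm (\<Phi> g)) U" by (rule tendsto_norm[OF \<Phi>])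
    moreover have "norm (blinfun_apply g (y n)) \<le> norm g * B" for n
      using norm_blinfun[of g "y n"] bd[of n] by (meson mult_left_mono norm_ge_zero order_trans)
    ultimately show "norm (\<Phi> g) \<le> norm g * B"
      using tendsto_upperbound[OF _ always_eventually U] by blast
  qed
  then have "blinfun_apply (Blinfun \<Phi>) g = \<Phi> g" for g
    by (simp add: bounded_linear_Blinfun_apply)
  moreover obtain v where "\<And>g. blinfun_apply (Blinfun \<Phi>) g = blinfun_apply g v"
    using refl unfolding reflexive_def by blast
  ultimately have v: "\<Phi> g = blinfun_apply g v" for g by simp
  have "((\<lambda>n. f (y n)) \<longlongrightarrow> f v) U" if "bounded_linear f" for f :: "'b \<Rightarrow> real"
    using \<Phi>[of "Blinfun f"] v[of "Blinfun f"] that by (simp add: bounded_linear_Blinfun_apply)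
  then show ?thesis unfolding weak_limit_def by blast
qed

text \<open>The choice is a true weak limit under the hypotheses of
  \<open>weak_limit_shift_limit\<close>. Its \<open>k\<close>-th iterate is the iterated weak limit
  of \<open>g\<close> over \<open>k\<close> added terms, the first added term being the outermost
  variable.\<close>

definition shift_limit :: "nat filter \<Rightarrow> (nat \<Rightarrow> 'a::real_normed_vector) \<Rightarrow> ('a \<Rightarrow> 'b::real_normed_vector) \<Rightarrow> 'a \<Rightarrow> 'b" where
  "shift_limit U x g s = (SOME v. weak_limit U (\<lambda>n. g (s + x n)) v)"

text \<open>The iterated quantifier "for \<open>U\<close>-most first indices, for
  \<open>U\<close>-most second indices, ...": each index is chosen knowing the previous ones, so it
  can be taken beyond them.\<close>

primrec iter_eventually :: "nat filter \<Rightarrow> (nat \<Rightarrow> 'a::real_vector) \<Rightarrow> nat \<Rightarrow> ('a \<Rightarrow> bool) \<Rightarrow> 'a \<Rightarrow> bool" where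
  "iter_eventually U x 0 P s = P s"
| "iter_eventually U x (Suc k) P s = eventually (\<lambda>n. iter_eventually U x k P (s + x n)) U"

lemma iter_eventually_mono:
  assumes "iter_eventually U x k P s" "\<And>s. P s \<Longrightarrow> Q s"
  shows "iter_eventually U x k Q s"
  using assms(1)
proof (induction k arbitrary: s)
  case 0
  then show ?case using assms(2) by simp
next
  case (Suc k)
  then show ?case by (auto elim: eventually_mono)
qed

text \<open>A real-valued way to say that the expansion modulus of \<open>g\<close> at scale
  \<open>b\<close> is at most \<open>D\<close>.\<close>

definition uniformly_moves :: "real \<Rightarrow> real \<Rightarrow> ('a::real_normed_vector \<Rightarrow> 'b::real_normed_vector) \<Rightarrow> bool" where
  "uniformly_moves b D g \<longleftrightarrow> (\<forall>s t. norm (s - t) \<le> b \<longrightarrow> norm (g s - g t) \<le> D)"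

context
  fixes U :: "nat filter" and x :: "nat \<Rightarrow> 'a::real_normed_vector" and b D :: real
  assumes U: "U \<noteq> bot" and ultra: "\<And>P. eventually P U \<or> eventually (\<lambda>n. \<not> P n) U"
    and x: "\<And>n. norm (x n) \<le> b"
begin

lemma weak_limit_shift_limit:
  fixes g :: "'a \<Rightarrow> 'b::real_normed_vector"
  assumes refl: "reflexive TYPE('b)" and g: "uniformly_moves (2 * b) D g"
  shows "weak_limit U (\<lambda>n. g (s + x n)) (shift_limit U x g s)"
proof -
  have b: "b \<ge> 0" using x[of 0] norm_ge_zero order_trans by blast
  have "norm (g (s + x n)) \<le> norm (g s) + D" for n
  proof -
    have "norm ((s + x n) - s) \<le> 2 * b" using x[of n] b by simp
    then have "norm (g (s + x n) - g s) \<le> D" using g unfolding uniformly_moves_def by blast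
    then show ?thesis using norm_triangle_ineq2[of "g (s + x n)" "g s"] by linarith
  qed
  from reflexive_weak_limit[OF refl U ultra this] show ?thesis
    unfolding shift_limit_def by (rule someI_ex)
qed

lemma uniformly_moves_shift_limit:
  fixes g :: "'a \<Rightarrow> 'b::real_normed_vector"
  assumes refl: "reflexive TYPE('b)" and g: "uniformly_moves (2 * b) D g"
  shows "uniformly_moves (2 * b) D (shift_limit U x g)"
  unfolding uniformly_moves_def
proof (intro allI impI)
  fix s t :: 'a assume st: "norm (s - t) \<le> 2 * b"
  show "norm (shift_limit U x g s - shift_limit U x g t) \<le> D"
  proof (rule weak_limit_norm_le[OF weak_limit_diff U])
    show "norm (g (s + x n) - g (t + x n)) \<le> D" for n
      using st g unfolding uniformly_moves_def by simp
  qed (rule weak_limit_shift_limit[OF refl g])+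
qed

lemma uniformly_moves_iterated_shift_limit:
  fixes g :: "'a \<Rightarrow> 'b::real_normed_vector"
  assumes refl: "reflexive TYPE('b)" and g: "uniformly_moves (2 * b) D g"
  shows "uniformly_moves (2 * b) D ((shift_limit U x ^^ k) g)"
  by (induction k) (auto intro: g uniformly_moves_shift_limit[OF refl])

text \<open>The norm bound compares \<open>g (s + x n)\<close> with \<open>g (s + x m)\<close> and
  lets \<open>m\<close> vary along \<open>U\<close>. The two arguments are up to
  \<open>2 * b\<close> apart, hence the scale \<open>2 * b\<close>.\<close>

lemma shift_limit_increment:
  fixes g :: "'a \<Rightarrow> 'b::real_normed_vector"
  assumes refl: "reflexive TYPE('b)" and g: "uniformly_moves (2 * b) D g"
  shows "weakly_null_along U (\<lambda>n. g (s + x n) - shift_limit U x g s)"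
    and "norm (g (s + x n) - shift_limit U x g s) \<le> D"
proof -
  have lim: "weak_limit U (\<lambda>n. g (s + x n)) (shift_limit U x g s)"
    by (rule weak_limit_shift_limit[OF refl g])
  have "weak_limit U (\<lambda>n. g (s + x n) - shift_limit U x g s) 0"
    using weak_limit_diff[OF lim weak_limit_const, of "shift_limit U x g s"] by simp
  moreover have "f 0 = 0" if "bounded_linear f" for f :: "'b \<Rightarrow> real"
    using that by (simp add: bounded_linear.linear linear_0)
  ultimately show "weakly_null_along U (\<lambda>n. g (s + x n) - shift_limit U x g s)"
    unfolding weak_limit_def weakly_null_along_def by metis
  show "norm (g (s + x n) - shift_limit U x g s) \<le> D"
  proof (rule weak_limit_norm_le[OF weak_limit_diff[OF weak_limit_const lim] U])
    fix m
    have "norm ((s + x n) - (s + x m)) \<le> 2 * b"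
      using norm_triangle_ineq4[of "x n" "x m"] x[of n] x[of m] by simp
    then show "norm (g (s + x n) - g (s + x m)) \<le> D" using g unfolding uniformly_moves_def by blast
  qed
qed

text \<open>The difference from the iterated limit telescopes into \<open>k\<close> weakly null
  increments of norm at most \<open>D\<close>, each adding \<open>K * D powr q\<close>. The
  arbitrary \<open>v\<close> carries the increments already made through the induction.\<close>

lemma aus_concentration:
  fixes g :: "'a \<Rightarrow> 'b::real_normed_vector"
  assumes refl: "reflexive TYPE('b)" and g: "uniformly_moves (2 * b) D g"
    and D: "D > 0"
    and K: "\<And>(z::nat \<Rightarrow> 'b) v. weakly_null_along U z \<Longrightarrow> (\<And>n. norm (z n) \<le> D) \<Longrightarrow>
      eventually (\<lambda>n. norm (v + z n) powr q \<le> norm v powr q + K * D powr q) U"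
  shows "iter_eventually U x k
    (\<lambda>S. norm (v + (g S - (shift_limit U x ^^ k) g s)) powr q \<le> norm v powr q + k * (K * D powr q)) s"
proof (induction k arbitrary: v s)
  case 0
  then show ?case by simp
next
  case (Suc k)
  define h where "h = (shift_limit U x ^^ k) g"
  have h: "uniformly_moves (2 * b) D h"
    unfolding h_def by (rule uniformly_moves_iterated_shift_limit[OF refl g])
  have "eventually (\<lambda>n. norm (v + (h (s + x n) - shift_limit U x h s)) powr q \<le> norm v powr q + K * D powr q) U"
    by (intro K shift_limit_increment[OF refl h])
  then show ?case
    unfolding iter_eventually.simps
  proof (rule eventually_mono)
    fix n assume n: "norm (v + (h (s + x n) - shift_limit U x h s)) powr q \<le> norm v powr q + K * D powr q"
    define v' where "v' = v + (h (s + x n) - shift_limit U x h s)"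
    have "iter_eventually U x k
      (\<lambda>S. norm (v' + (g S - h (s + x n))) powr q \<le> norm v' powr q + k * (K * D powr q)) (s + x n)"
      unfolding h_def by (rule Suc.IH)
    then show "iter_eventually U x k (\<lambda>S. norm (v + (g S - (shift_limit U x ^^ Suc k) g s)) powr q
        \<le> norm v powr q + Suc k * (K * D powr q)) (s + x n)"
    proof (rule iter_eventually_mono)
      fix S assume S: "norm (v' + (g S - h (s + x n))) powr q \<le> norm v' powr q + k * (K * D powr q)"
      have eq: "v' + (g S - h (s + x n)) = v + (g S - (shift_limit U x ^^ Suc k) g s)"
        by (simp add: v'_def h_def)
      have "norm v' powr q \<le> norm v powr q + K * D powr q" using n by (simp only: v'_def)
      moreover have "Suc k * (K * D powr q) = K * D powr q + k * (K * D powr q)" by (simp add: algebra_simps)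
      ultimately show "norm (v + (g S - (shift_limit U x ^^ Suc k) g s)) powr q
        \<le> norm v powr q + Suc k * (K * D powr q)"
        using S[unfolded eq] by linarith
    qed
  qed
qed

end

section \<open>Weakly Cauchy subsequences or long alternating sums\<close>

fun alternates :: "('n \<Rightarrow> bool) \<Rightarrow> ('n \<Rightarrow> bool) \<Rightarrow> 'n list \<Rightarrow> bool" where
  "alternates P Q [] = True"
| "alternates P Q (n # l) = (P n \<and> alternates Q P l)"

fun alternating_sum :: "('n \<Rightarrow> 'a::ab_group_add) \<Rightarrow> 'n list \<Rightarrow> 'a" where
  "alternating_sum x [] = 0"
| "alternating_sum x (n # l) = x n - alternating_sum x l"

lemma alternates_map: "alternates P Q (map f l) \<longleftrightarrow> alternates (P \<circ> f) (Q \<circ> f) l"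
  by (induction l arbitrary: P Q) auto

lemma alternating_sum_map: "alternating_sum x (map f l) = alternating_sum (x \<circ> f) l"
  by (induction l) auto

text \<open>Each of the \<open>k\<close> consecutive pairs contributes at least
  \<open>\<beta> - \<alpha>\<close>.\<close>

lemma alternating_sum_ge:
  fixes \<phi> :: "'a::real_vector \<Rightarrow> real"
  assumes "linear \<phi>" "length l = 2 * k"
    and "alternates (\<lambda>n. \<beta> < \<phi> (x n)) (\<lambda>n. \<phi> (x n) < \<alpha>) l"
  shows "k * (\<beta> - \<alpha>) \<le> \<phi> (alternating_sum x l)"
  using assms(2,3)
proof (induction k arbitrary: l)
  case 0
  then show ?case using assms(1) by (simp add: linear_0)
next
  case (Suc k)
  then obtain n m l' where l: "l = n # m # l'"
    by (metis Suc_length_conv mult_Suc_right add_2_eq_Suc)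
  have "k * (\<beta> - \<alpha>) \<le> \<phi> (alternating_sum x l')" using Suc l by auto
  moreover have "\<phi> (alternating_sum x l) = \<phi> (x n) - \<phi> (x m) + \<phi> (alternating_sum x l')"
    using assms(1) l by (simp add: linear_diff)
  ultimately show ?case using Suc.prems l by (simp add: algebra_simps)
qed

lemma alternating_list_exists:
  fixes P Q :: "nat \<Rightarrow> bool"
  assumes "\<And>N. \<exists>n\<ge>N. P n" "\<And>N. \<exists>n\<ge>N. Q n"
  shows "\<exists>l. length l = k \<and> sorted_wrt (<) l \<and> (\<forall>i\<in>set l. N \<le> i) \<and> alternates P Q l"
  using assms
proof (induction k arbitrary: N P Q)
  case (Suc k)
  obtain n where n: "n \<ge> N" "P n" using Suc.prems(1) by blast
  obtain l where "length l = k" "sorted_wrt (<) l" "\<forall>i\<in>set l. Suc n \<le> i" "alternates Q P l"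
    using Suc.IH[OF Suc.prems(2,1), of "Suc n"] by blast
  with n show ?case by (intro exI[of _ "n # l"]) auto
qed simp

text \<open>Ramsey's theorem, with a \<open>k\<close>-element set coloured by \<open>R\<close> of
  its increasing enumeration; \<open>r\<close> enumerates the homogeneous set.\<close>

lemma Ramsey_sequence:
  fixes R :: "nat list \<Rightarrow> bool"
  shows "\<exists>r::nat \<Rightarrow> nat. strict_mono r \<and>
    ((\<forall>l. sorted_wrt (<) l \<and> length l = k \<longrightarrow> R (map r l)) \<or>
     (\<forall>l. sorted_wrt (<) l \<and> length l = k \<longrightarrow> \<not> R (map r l)))"
proof -
  define f where "f X = (if R (sorted_list_of_set X) then 0 else 1 :: nat)" for X
  have "\<forall>X. X \<subseteq> UNIV \<and> finite X \<and> card X = k \<longrightarrow> f X < 2" by (simp add: f_def)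
  from Ramsey[OF infinite_UNIV_nat this] obtain Y t where Y: "infinite Y"
    and "\<forall>X. X \<subseteq> Y \<and> finite X \<and> card X = k \<longrightarrow> f X = t"
    by (elim exE conjE)
  then have t: "\<And>X. X \<subseteq> Y \<Longrightarrow> finite X \<Longrightarrow> card X = k \<Longrightarrow> f X = t" by simp
  define r where "r = enumerate Y"
  have r: "strict_mono r" unfolding r_def by (rule strict_mono_enumerate[OF Y])
  have "f (set (map r l)) = t" "sorted_list_of_set (set (map r l)) = map r l"
    if l: "sorted_wrt (<) l" "length l = k" for l
  proof -
    have s: "sorted_wrt (<) (map r l)"
      unfolding sorted_wrt_map using l(1) by (rule sorted_wrt_mono_rel[rotated]) (use r in \<open>auto simp: strict_mono_def\<close>)
    then show "sorted_list_of_set (set (map r l)) = map r l"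
      by (metis finite_set sorted_list_of_set_unique strict_sorted_iff distinct_card)
    have "card (set (map r l)) = k" using s l(2) distinct_card strict_sorted_iff length_map by metis
    moreover have "set (map r l) \<subseteq> Y" using enumerate_in_set[OF Y] by (auto simp: r_def)
    ultimately show "f (set (map r l)) = t" by (intro t) auto
  qed
  then have *: "R (map r l) \<longleftrightarrow> t = 0" if "sorted_wrt (<) l" "length l = k" for l
    using that unfolding f_def by (metis zero_neq_one)
  show ?thesis
    by (rule exI[of _ r], cases "t = 0") (use r * in auto)
qed

text \<open>Two rationals fit strictly between the lower and upper limits. Rational levels leave
  only countably many gaps for the diagonal argument.\<close>

lemma not_convergent_imp_oscillates:
  fixes c :: "nat \<Rightarrow> real"
  assumes bd: "\<And>n. \<bar>c n\<bar> \<le> B" and "\<not> convergent c"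
  shows "\<exists>a b :: rat. a < b \<and> (\<forall>N. \<exists>n\<ge>N. real_of_rat b < c n) \<and> (\<forall>N. \<exists>n\<ge>N. c n < real_of_rat a)"
proof -
  define X where "X n = ereal (c n)" for n
  have "liminf X \<noteq> limsup X"
  proof
    assume eq: "liminf X = limsup X"
    have lim: "X \<longlonglongrightarrow> liminf X" by (rule tendsto_Liminf) (use eq in auto)
    have "ereal (- B) \<le> liminf X"
      by (rule Liminf_bounded, rule always_eventually) (use bd in \<open>auto simp: X_def abs_le_iff minus_le_iff\<close>)
    moreover have "limsup X \<le> ereal B"
      by (rule Limsup_bounded, rule always_eventually) (use bd in \<open>auto simp: X_def abs_le_iff\<close>)
    ultimately obtain L where "liminf X = ereal L" using eq by (cases "limsup X") auto
    with lim have "c \<longlonglongrightarrow> L" by (simp add: X_def[abs_def])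
    with assms(2) show False by (auto simp: convergent_def)
  qed
  then have "liminf X < limsup X" using Liminf_le_Limsup[of sequentially X] by (simp add: less_le)
  then obtain a :: rat where a: "liminf X < real_of_rat a" "real_of_rat a < limsup X"
    using ereal_dense3 by blast
  then obtain b :: rat where b: "real_of_rat a < ereal (real_of_rat b)" "real_of_rat b < limsup X"
    using ereal_dense3 by blast
  have "\<exists>n\<ge>N. real_of_rat b < c n" for N
  proof (rule ccontr)
    assume "\<not> ?thesis"
    then have "eventually (\<lambda>n. X n \<le> ereal (real_of_rat b)) sequentially"
      unfolding eventually_sequentially X_def by (meson ereal_less_eq(3) not_le)
    from Limsup_bounded[OF this] b(2) show False by simp
  qed
  moreover have "\<exists>n\<ge>N. c n < real_of_rat a" for N
  proof (rule ccontr)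
    assume "\<not> ?thesis"
    then have "eventually (\<lambda>n. ereal (real_of_rat a) \<le> X n) sequentially"
      unfolding eventually_sequentially X_def by (meson ereal_less_eq(3) not_le)
    from Liminf_bounded[OF this] a(1) show False by simp
  qed
  moreover have "a < b" using b(1) by (simp add: of_rat_less)
  ultimately show ?thesis by blast
qed

text \<open>The functional may depend on the list, so this is a property of finite index sets, to
  which Ramsey's theorem applies.\<close>

definition functional_alternates :: "(nat \<Rightarrow> 'a::real_normed_vector) \<Rightarrow> real \<Rightarrow> real \<Rightarrow> nat list \<Rightarrow> bool" where
  "functional_alternates x \<alpha> \<beta> l \<longleftrightarrow> (\<exists>\<phi>::'a \<Rightarrow> real. bounded_linear \<phi> \<and> (\<forall>y. \<bar>\<phi> y\<bar> \<le> norm y) \<and>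
     alternates (\<lambda>n. \<beta> < \<phi> (x n)) (\<lambda>n. \<phi> (x n) < \<alpha>) l)"

text \<open>If, for all rational \<open>\<alpha> < \<beta>\<close>, one can pass to subsequences on which no functional of norm at most 1
  oscillates across \<open>[\<alpha>, \<beta>]\<close> arbitrarily often, a diagonal subsequence is weakly Cauchy. Otherwise Ramsey's
  theorem turns the oscillation into a property of all index sets of size 2k.\<close>

lemma weakly_Cauchy_or_alternating:
  fixes x :: "nat \<Rightarrow> 'a::real_normed_vector"
  assumes bd: "\<And>n. norm (x n) \<le> B"
  shows "(\<exists>r::nat \<Rightarrow> nat. strict_mono r \<and> (\<forall>\<phi>::'a \<Rightarrow> real. bounded_linear \<phi> \<longrightarrow> convergent (\<lambda>n. \<phi> (x (r n))))) \<or>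
    (\<exists>\<delta>>0. \<forall>k. \<exists>r::nat \<Rightarrow> nat. strict_mono r \<and>
       (\<forall>l. sorted_wrt (<) l \<and> length l = 2 * k \<longrightarrow> k * \<delta> \<le> norm (alternating_sum (x \<circ> r) l)))"
proof (cases "\<exists>\<alpha> \<beta> s. \<alpha> < \<beta> \<and> strict_mono (s::nat \<Rightarrow> nat) \<and> (\<forall>k r. strict_mono (r::nat \<Rightarrow> nat) \<longrightarrow>
    (\<exists>l. sorted_wrt (<) l \<and> length l = 2 * k \<and> functional_alternates x \<alpha> \<beta> (map (s \<circ> r) l)))")
  case True
  then obtain \<alpha> \<beta> s where ab: "\<alpha> < \<beta>" and s: "strict_mono (s::nat \<Rightarrow> nat)"
    and ex: "\<And>k r. strict_mono (r::nat \<Rightarrow> nat) \<Longrightarrow>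
      \<exists>l. sorted_wrt (<) l \<and> length l = 2 * k \<and> functional_alternates x \<alpha> \<beta> (map (s \<circ> r) l)"
    by blast
  have "\<exists>r::nat \<Rightarrow> nat. strict_mono r \<and>
       (\<forall>l. sorted_wrt (<) l \<and> length l = 2 * k \<longrightarrow> k * (\<beta> - \<alpha>) \<le> norm (alternating_sum (x \<circ> r) l))" for k
  proof -
    obtain r :: "nat \<Rightarrow> nat" where r: "strict_mono r"
      and hom: "(\<forall>l. sorted_wrt (<) l \<and> length l = 2 * k \<longrightarrow> functional_alternates x \<alpha> \<beta> (map s (map r l))) \<or>
        (\<forall>l. sorted_wrt (<) l \<and> length l = 2 * k \<longrightarrow> \<not> functional_alternates x \<alpha> \<beta> (map s (map r l)))"
      using Ramsey_sequence[of "2 * k" "\<lambda>l. functional_alternates x \<alpha> \<beta> (map s l)"] by blast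
    \<comment> \<open>The negative alternative is impossible: \<open>ex\<close> finds an alternating
      list in every subsequence. The subsequence depends on \<open>k\<close>, the gap
      \<open>\<beta> - \<alpha>\<close> does not.\<close>
    have all: "functional_alternates x \<alpha> \<beta> (map (s \<circ> r) l)" if "sorted_wrt (<) l" "length l = 2 * k" for l
      using hom ex[OF r, of k] that by (metis map_map)
    have "k * (\<beta> - \<alpha>) \<le> norm (alternating_sum (x \<circ> (s \<circ> r)) l)" if l: "sorted_wrt (<) l" "length l = 2 * k" for l
    proof -
      obtain \<phi> :: "'a \<Rightarrow> real" where \<phi>: "bounded_linear \<phi>" "\<And>y. \<bar>\<phi> y\<bar> \<le> norm y"
        "alternates (\<lambda>n. \<beta> < \<phi> (x n)) (\<lambda>n. \<phi> (x n) < \<alpha>) (map (s \<circ> r) l)"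
        using all[OF l] unfolding functional_alternates_def by blast
      have "k * (\<beta> - \<alpha>) \<le> \<phi> (alternating_sum x (map (s \<circ> r) l))"
        using \<phi>(1,3) l(2) by (intro alternating_sum_ge) (auto simp: bounded_linear.linear)
      also have "\<dots> \<le> norm (alternating_sum x (map (s \<circ> r) l))" using \<phi>(2) abs_le_D1 by blast
      finally show ?thesis by (simp add: alternating_sum_map)
    qed
    moreover have "strict_mono (s \<circ> r)" using s r by (rule strict_mono_o)
    ultimately show ?thesis by blast
  qed
  then show ?thesis using ab by (intro disjI2 exI[of _ "\<beta> - \<alpha>"]) simp
next
  case False
  \<comment> \<open>\<open>n\<close> codes a pair of rational levels, and \<open>P n s\<close>
    bounds the number of oscillations across them along \<open>s\<close>.\<close>
  define P where "P n s \<longleftrightarrow> (case from_nat n of (a::rat, b::rat) \<Rightarrow> a < b \<longrightarrow> (\<exists>k. \<forall>l. sorted_wrt (<) l \<and> length l = 2 * k \<longrightarrow>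
      \<not> functional_alternates x (real_of_rat a) (real_of_rat b) (map (s::nat \<Rightarrow> nat) l)))" for n s
  interpret subseqs P
  proof
    fix n and s :: "nat \<Rightarrow> nat" assume s: "strict_mono s"
    obtain a b :: rat where ab: "from_nat n = (a, b)" by fastforce
    show "\<exists>r'. strict_mono r' \<and> P n (s \<circ> r')"
    proof (cases "a < b")
      case True
      then have "real_of_rat a < real_of_rat b" by (simp add: of_rat_less)
      with False s obtain k r where "strict_mono (r::nat \<Rightarrow> nat)"
        "\<forall>l. sorted_wrt (<) l \<and> length l = 2 * k \<longrightarrow>
          \<not> functional_alternates x (real_of_rat a) (real_of_rat b) (map (s \<circ> r) l)"
        by blast
      then show ?thesis unfolding P_def ab by auto
    next
      case False
      then show ?thesis unfolding P_def ab by (auto intro: strict_mono_id)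
    qed
  qed
  \<comment> \<open>Increasing lists stay increasing under \<open>r\<close>, so the bound survives
    further thinning and reaches a tail of the diagonal sequence.\<close>
  have stable: "P n (s \<circ> r)" if r: "strict_mono r" and P: "P n s" for r s n
  proof -
    obtain a b :: rat where ab: "from_nat n = (a, b)" by fastforce
    have sorted: "sorted_wrt (<) (map r l)" if "sorted_wrt (<) l" for l
      unfolding sorted_wrt_map using that by (rule sorted_wrt_mono_rel[rotated]) (use r in \<open>auto simp: strict_mono_def\<close>)
    show ?thesis
      unfolding P_def ab prod.case
    proof
      assume "a < b"
      then obtain k where k: "\<forall>l. sorted_wrt (<) l \<and> length l = 2 * k \<longrightarrow>
          \<not> functional_alternates x (real_of_rat a) (real_of_rat b) (map s l)"
        using P unfolding P_def ab prod.case by blast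
      have "\<not> functional_alternates x (real_of_rat a) (real_of_rat b) (map (s \<circ> r) l)"
        if "sorted_wrt (<) l \<and> length l = 2 * k" for l
        using k[rule_format, of "map r l"] sorted[of l] that by simp
      then show "\<exists>k. \<forall>l. sorted_wrt (<) l \<and> length l = 2 * k \<longrightarrow>
          \<not> functional_alternates x (real_of_rat a) (real_of_rat b) (map (s \<circ> r) l)"
        by blast
    qed
  qed
  define d where "d = diagseq"
  have diag: "P n (d \<circ> (+) (Suc n))" for n unfolding d_def by (rule diagseq_holds[OF stable])
  have conv1: "convergent (\<lambda>n. \<phi> (x (d n)))" if \<phi>: "bounded_linear \<phi>" "\<And>y. \<bar>\<phi> y\<bar> \<le> norm y" for \<phi> :: "'a \<Rightarrow> real"
  proof (rule ccontr)
    assume nc: "\<not> convergent (\<lambda>n. \<phi> (x (d n)))"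
    have "\<bar>\<phi> (x (d n))\<bar> \<le> B" for n using \<phi>(2) bd order_trans by blast
    from not_convergent_imp_oscillates[OF this nc]
    obtain a b :: rat where ab: "a < b" and up: "\<And>N. \<exists>n\<ge>N. real_of_rat b < \<phi> (x (d n))"
      and down: "\<And>N. \<exists>n\<ge>N. \<phi> (x (d n)) < real_of_rat a" by blast
    define i where "i = to_nat (a, b)"
    obtain k where k: "\<And>l. sorted_wrt (<) l \<Longrightarrow> length l = 2 * k \<Longrightarrow>
      \<not> functional_alternates x (real_of_rat a) (real_of_rat b) (map (d \<circ> (+) (Suc i)) l)"
      using diag[of i] ab unfolding P_def i_def by auto
    have "\<exists>n\<ge>N. real_of_rat b < \<phi> (x (d (Suc i + n)))" for N
      using up[of "Suc i + N"] by (metis le_add_diff_inverse add_leD1 add_le_cancel_left)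
    moreover have "\<exists>n\<ge>N. \<phi> (x (d (Suc i + n))) < real_of_rat a" for N
      using down[of "Suc i + N"] by (metis le_add_diff_inverse add_leD1 add_le_cancel_left)
    ultimately obtain l where l: "length l = 2 * k" "sorted_wrt (<) l"
      and alt: "alternates (\<lambda>n. real_of_rat b < \<phi> (x (d (Suc i + n)))) (\<lambda>n. \<phi> (x (d (Suc i + n))) < real_of_rat a) l"
      using alternating_list_exists[of "\<lambda>n. real_of_rat b < \<phi> (x (d (Suc i + n)))"
          "\<lambda>n. \<phi> (x (d (Suc i + n))) < real_of_rat a" "2 * k" 0] by blast
    have "functional_alternates x (real_of_rat a) (real_of_rat b) (map (d \<circ> (+) (Suc i)) l)"
      unfolding functional_alternates_def alternates_map using \<phi> alt by (auto simp: o_def)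
    with k[OF l(2,1)] show False by blast
  qed
  have "convergent (\<lambda>n. \<phi> (x (d n)))" if \<phi>: "bounded_linear \<phi>" for \<phi> :: "'a \<Rightarrow> real"
  proof -
    obtain K where K: "K > 0" "\<And>y. norm (\<phi> y) \<le> norm y * K" using bounded_linear.pos_bounded[OF \<phi>] by blast
    \<comment> \<open>Rescaling reduces a general functional to the unit ball, where
      \<open>conv1\<close> applies.\<close>
    have "convergent (\<lambda>n. (1 / K) * \<phi> (x (d n)))"
    proof (rule conv1)
      show "bounded_linear (\<lambda>y. 1 / K * \<phi> y)" using \<phi> by (rule bounded_linear_const_mult)
      show "\<bar>1 / K * \<phi> y\<bar> \<le> norm y" for y using K(2)[of y] K(1) by (simp add: abs_mult field_simps)
    qed
    then have "convergent (\<lambda>n. K * ((1 / K) * \<phi> (x (d n))))" by (rule convergent_mult[OF convergent_const])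
    then show ?thesis using K(1) by simp
  qed
  moreover have "strict_mono d" unfolding d_def by (rule subseq_diagseq)
  ultimately show ?thesis by blast
qed

section \<open>The compression exponent\<close>

lemma iter_eventually_Suc_obtain:
  assumes "iter_eventually U x (Suc k) P s" "U \<noteq> bot" "U \<le> sequentially"
  obtains n where "N \<le> n" "iter_eventually U x k P (s + x n)"
proof -
  have "eventually (\<lambda>n. N \<le> n) U" using assms(3) eventually_ge_at_top by (rule filter_leD)
  then have "eventually (\<lambda>n. N \<le> n \<and> iter_eventually U x k P (s + x n)) U"
    using assms(1) by (simp add: eventually_conj)
  with assms(2) that show thesis using eventually_happens' by blast
qed

text \<open>The indices of the two sums are chosen in turn, each beyond the last, so that their
  difference is one alternating sum over an increasing list.\<close>

lemma iter_eventually_interlaced: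
  assumes "U \<noteq> bot" "U \<le> sequentially" "iter_eventually U x k P s" "iter_eventually U x k P t"
  shows "\<exists>l S T. length l = 2 * k \<and> sorted_wrt (<) l \<and> (\<forall>i\<in>set l. N \<le> i) \<and> P S \<and> P T \<and>
    S - T = s - t + alternating_sum x l"
  using assms(3,4)
proof (induction k arbitrary: s t N)
  case 0
  then show ?case by (intro exI[of _ "[]"] exI[of _ s] exI[of _ t]) simp
next
  case (Suc k)
  obtain n where n: "N \<le> n" "iter_eventually U x k P (s + x n)"
    using iter_eventually_Suc_obtain[OF Suc.prems(1) assms(1,2)] by blast
  obtain m where m: "Suc n \<le> m" "iter_eventually U x k P (t + x m)"
    using iter_eventually_Suc_obtain[OF Suc.prems(2) assms(1,2)] by blast
  obtain l S T where l: "length l = 2 * k" "sorted_wrt (<) l" "\<forall>i\<in>set l. Suc m \<le> i" "P S" "P T"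
    "S - T = (s + x n) - (t + x m) + alternating_sum x l"
    using Suc.IH[OF n(2) m(2), of "Suc m"] by blast
  have "\<forall>i\<in>set l. n < i \<and> m < i \<and> N \<le> i" using l(3) n(1) m(1) by force
  moreover have "S - T = s - t + alternating_sum x (n # m # l)"
    using l(6) by (simp add: algebra_simps)
  ultimately show ?case
    using l n m by (intro exI[of _ "n # m # l"] exI[of _ S] exI[of _ T]) auto
qed

lemma iter_eventually_select:
  assumes "U \<noteq> bot" "U \<le> sequentially" "iter_eventually U x k P s"
  shows "\<exists>J. finite J \<and> card J = k \<and> (\<forall>j\<in>J. N \<le> j) \<and> P (s + (\<Sum>j\<in>J. x j))"
  using assms(3)
proof (induction k arbitrary: s N)
  case 0
  then show ?case by (intro exI[of _ "{}"]) simp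
next
  case (Suc k)
  obtain n where n: "N \<le> n" "iter_eventually U x k P (s + x n)"
    using iter_eventually_Suc_obtain[OF Suc.prems assms(1,2)] by blast
  obtain J where J: "finite J" "card J = k" "\<forall>j\<in>J. Suc n \<le> j" "P ((s + x n) + (\<Sum>j\<in>J. x j))"
    using Suc.IH[OF n(2), of "Suc n"] by blast
  have "n \<notin> J" using J(3) by auto
  with J n show ?case by (intro exI[of _ "insert n J"]) (auto simp: add.assoc)
qed

text \<open>Every summand can be chosen with a value of \<open>\<phi>\<close> below
  \<open>\<epsilon>\<close>. This later supplies a second sum that a given functional hardly
  sees.\<close>

lemma iter_eventually_functional_small:
  fixes \<phi> :: "'a::real_vector \<Rightarrow> real" and \<epsilon> :: real
  assumes "U \<noteq> bot" "((\<lambda>n. \<phi> (x n)) \<longlongrightarrow> 0) U" "linear \<phi>" "\<epsilon> > 0" "iter_eventually U x k P s"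
  shows "\<exists>S. P S \<and> \<bar>\<phi> S - \<phi> s\<bar> \<le> k * \<epsilon>"
  using assms(5)
proof (induction k arbitrary: s)
  case 0
  then show ?case by auto
next
  case (Suc k)
  have "eventually (\<lambda>n. \<bar>\<phi> (x n)\<bar> < \<epsilon>) U" using tendstoD[OF assms(2,4)] by simp
  with Suc.prems have "eventually (\<lambda>n. \<bar>\<phi> (x n)\<bar> < \<epsilon> \<and> iter_eventually U x k P (s + x n)) U"
    by (simp add: eventually_conj)
  with assms(1) obtain n where n: "\<bar>\<phi> (x n)\<bar> < \<epsilon>" "iter_eventually U x k P (s + x n)"
    using eventually_happens' by blast
  obtain S where S: "P S" "\<bar>\<phi> S - \<phi> (s + x n)\<bar> \<le> k * \<epsilon>" using Suc.IH[OF n(2)] by blast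
  have "\<phi> (s + x n) = \<phi> s + \<phi> (x n)" using assms(3) by (rule linear_add)
  with S(2) n(1) have "\<bar>\<phi> S - \<phi> s\<bar> \<le> k * \<epsilon> + \<epsilon>" by linarith
  with S(1) show ?case by (auto simp: algebra_simps)
qed

text \<open>The order of quantifiers matters: \<open>B\<close> is fixed before the sequence and
  before \<open>k\<close>, so the sequence may later be chosen depending on \<open>k\<close>. It
  comes from \<open>aus_concentration\<close> with \<open>v = 0\<close> by taking
  \<open>q\<close>-th roots.\<close>

lemma concentration:
  fixes f :: "'a::real_normed_vector \<Rightarrow> 'b::real_normed_vector"
  assumes refl: "reflexive TYPE('b)" and aus: "asymptotically_uniformly_smooth q TYPE('b)" and q: "q \<ge> 1"
    and f: "uniformly_moves (2 * b) D f" and D: "D > 0"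
  shows "\<exists>B>0. \<forall>x. (\<forall>n. norm (x n) \<le> b) \<longrightarrow> (\<exists>U. U \<noteq> bot \<and> U \<le> sequentially \<and>
    (\<forall>k. \<exists>u. iter_eventually U x k (\<lambda>S. norm (f S - u) \<le> B * k powr (1/q)) 0))"
proof -
  obtain K where K: "K > 0" and step: "\<And>(U::nat filter) (z::nat \<Rightarrow> 'b) v. weakly_null_along U z \<Longrightarrow> (\<And>n. norm (z n) \<le> D) \<Longrightarrow>
    eventually (\<lambda>n. norm (v + z n) powr q \<le> norm v powr q + K * D powr q) U"
    using aus_weakly_null_step[OF aus q, where 'i = nat] D by blast
  obtain U :: "nat filter" where U: "U \<le> sequentially" "U \<noteq> bot"
    and ultra: "\<And>P. eventually P U \<or> eventually (\<lambda>n. \<not> P n) U"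
    using ultrafilter_below[OF sequentially_bot] by blast
  define B where "B = K powr (1/q) * D"
  have "iter_eventually U x k (\<lambda>S. norm (f S - (shift_limit U x ^^ k) f 0) \<le> B * k powr (1/q)) 0"
    if x: "\<And>n. norm (x n) \<le> b" for x k
  proof -
    have "iter_eventually U x k (\<lambda>S. norm (0 + (f S - (shift_limit U x ^^ k) f 0)) powr q
        \<le> norm (0::'b) powr q + k * (K * D powr q)) 0"
      by (rule aus_concentration[OF U(2) ultra x refl f D step])
    then show ?thesis
    proof (rule iter_eventually_mono)
      fix S assume "norm (0 + (f S - (shift_limit U x ^^ k) f 0)) powr q \<le> norm (0::'b) powr q + k * (K * D powr q)"
      then have "norm (f S - (shift_limit U x ^^ k) f 0) powr q \<le> k * (K * D powr q)" by simp
      then have "(norm (f S - (shift_limit U x ^^ k) f 0) powr q) powr (1/q) \<le> (k * (K * D powr q)) powr (1/q)"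
        using q by (intro powr_mono2) auto
      also have "\<dots> = B * k powr (1/q)"
        using q K D by (simp add: B_def powr_mult powr_powr)
      finally show "norm (f S - (shift_limit U x ^^ k) f 0) \<le> B * k powr (1/q)"
        using q by (simp add: powr_powr)
    qed
  qed
  with U have "\<forall>x. (\<forall>n. norm (x n) \<le> b) \<longrightarrow> (\<exists>U. U \<noteq> bot \<and> U \<le> sequentially \<and>
    (\<forall>k. \<exists>u. iter_eventually U x k (\<lambda>S. norm (f S - u) \<le> B * k powr (1/q)) 0))"
    by blast
  moreover have "B > 0" using K D by (simp add: B_def)
  ultimately show ?thesis by blast
qed

lemma filterlim_nat_powr_at_top:
  assumes "a > 0"
  shows "filterlim (\<lambda>j. real j powr a) at_top sequentially"
  unfolding filterlim_at_top
proof
  fix Z :: real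
  have "eventually (\<lambda>j. max Z 0 powr (1/a) \<le> real j) sequentially"
    using filterlim_real_sequentially unfolding filterlim_at_top by blast
  then show "eventually (\<lambda>j. Z \<le> real j powr a) sequentially"
  proof (rule eventually_mono)
    fix j assume "max Z 0 powr (1/a) \<le> real j"
    then have "(max Z 0 powr (1/a)) powr a \<le> real j powr a" using assms by (intro powr_mono2) auto
    then show "Z \<le> real j powr a" using assms by (simp add: powr_powr)
  qed
qed

text \<open>The left side grows like \<open>k powr (\<alpha>/p)\<close> up to the factor from
  \<open>\<theta>\<close>, which is smaller than any power; it can stay below
  \<open>k powr (1/q)\<close> only if \<open>\<alpha>/p \<le> 1/q\<close>.\<close>

lemma exponent_bound:
  fixes \<alpha> p q c L B :: real and \<theta> :: "nat \<Rightarrow> real"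
  assumes pos: "0 < \<alpha>" "0 < p" "0 < q" "0 < c" "0 < L" "0 < B"
    and \<theta>: "\<And>j. 1 \<le> \<theta> j" "\<And>a. a > 0 \<Longrightarrow> filterlim (\<lambda>j. real j powr a / \<theta> j) at_top sequentially"
    and le: "\<And>k::nat. k \<ge> 1 \<Longrightarrow> (c * (k powr (1/p) / \<theta> k)) powr \<alpha> / L - L \<le> B * k powr (1/q)"
  shows "\<alpha> \<le> p / q"
proof (rule ccontr)
  assume "\<not> \<alpha> \<le> p / q"
  then have "p < \<alpha> * q" using pos by (simp add: field_simps)
  \<comment> \<open>The surplus exponent: \<open>k powr (1/p)\<close> is
    \<open>k powr \<beta>\<close> times a factor whose \<open>\<alpha>\<close>-th power is
    \<open>k powr (1/q)\<close>.\<close>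
  define \<beta> where "\<beta> = 1/p - 1/(q * \<alpha>)"
  have \<beta>: "\<beta> > 0" using \<open>p < \<alpha> * q\<close> pos by (simp add: \<beta>_def field_simps)
  \<comment> \<open>Chosen so that \<open>A * Q \<le> L * (B + L) * Q\<close> becomes
    \<open>Q \<le> 0\<close>; \<open>Z\<close> is the threshold for
    \<open>k powr \<beta> / \<theta> k\<close> that produces \<open>A\<close>.\<close>
  define A where "A = L * (B + L) + 1"
  define Z where "Z = A powr (1/\<alpha>) / c"
  have A: "A > 0" using pos by (simp add: A_def add_pos_pos)
  have "eventually (\<lambda>j. Z \<le> real j powr \<beta> / \<theta> j \<and> 1 \<le> j) sequentially"
    using \<theta>(2)[OF \<beta>] eventually_ge_at_top[of 1] by (auto simp: filterlim_at_top intro: eventually_conj)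
  then obtain k where k: "Z \<le> real k powr \<beta> / \<theta> k" "1 \<le> k"
    using eventually_happens'[OF sequentially_bot] by blast
  define Q where "Q = real k powr (1/q)"
  have Q: "Q \<ge> 1" unfolding Q_def using k(2) pos by (intro ge_one_powr_ge_zero) auto
  have "A powr (1/\<alpha>) \<le> c * (k powr \<beta> / \<theta> k)" using k(1) pos by (simp add: Z_def field_simps)
  then have "(A powr (1/\<alpha>)) powr \<alpha> \<le> (c * (k powr \<beta> / \<theta> k)) powr \<alpha>"
    using pos by (intro powr_mono2) auto
  then have Ale: "A \<le> (c * (k powr \<beta> / \<theta> k)) powr \<alpha>" using pos A by (simp add: powr_powr)
  have "k powr (1/p) = k powr \<beta> * k powr (1/(q * \<alpha>))"
    by (simp add: \<beta>_def powr_add[symmetric])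
  then have "c * (k powr (1/p) / \<theta> k) = (c * (k powr \<beta> / \<theta> k)) * k powr (1/(q * \<alpha>))" by simp
  moreover have "0 \<le> c * (k powr \<beta> / \<theta> k)" using pos \<theta>(1)[of k] by simp
  ultimately have "(c * (k powr (1/p) / \<theta> k)) powr \<alpha> = (c * (k powr \<beta> / \<theta> k)) powr \<alpha> * (k powr (1/(q * \<alpha>))) powr \<alpha>"
    by (simp only: powr_mult powr_ge_zero)
  also have "(k powr (1/(q * \<alpha>))) powr \<alpha> = Q" using pos by (simp add: powr_powr Q_def)
  finally have "A * Q \<le> (c * (k powr (1/p) / \<theta> k)) powr \<alpha>" using Ale Q by (simp add: mult_right_mono)
  also have "\<dots> \<le> L * (B * Q + L)"
    using le[OF k(2)] pos by (simp add: Q_def field_simps)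
  also have "\<dots> \<le> L * (B * Q + L * Q)" using Q pos by (intro mult_left_mono add_left_mono) auto
  finally have "Q \<le> 0" by (simp add: A_def algebra_simps)
  with Q show False by simp
qed

text \<open>Two sums whose images lie near a common centre \<open>u\<close> are found far apart in
  the domain, and \<open>exponent_bound\<close> compares the two rates. The case
  \<open>\<alpha> = 1\<close> will exclude coarse Lipschitz embeddings.\<close>

lemma compression_le:
  fixes f :: "'a::real_normed_vector \<Rightarrow> 'b::real_normed_vector"
  assumes p: "1 < p" and q: "p < q"
    and inf: "infinite_dimensional TYPE('a)" and BS: "almost_co_BS p TYPE('a)"
    and refl: "reflexive TYPE('b)" and aus: "asymptotically_uniformly_smooth q TYPE('b)"
    and moves: "uniformly_moves 4 D f" and pos: "0 < D" "0 < L" "0 < \<alpha>"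
    and lower: "\<And>x y. norm (x - y) powr \<alpha> / L - L \<le> norm (f x - f y)"
  shows "\<alpha> \<le> p / q"
proof -
  obtain B where B: "B > 0" and conc: "\<And>x::nat \<Rightarrow> 'a. (\<And>n. norm (x n) \<le> 2) \<Longrightarrow> \<exists>U. U \<noteq> bot \<and> U \<le> sequentially \<and>
      (\<forall>k. \<exists>u. iter_eventually U x k (\<lambda>S. norm (f S - u) \<le> B * k powr (1/q)) 0)"
    using concentration[OF refl aus, of 2 D f] moves pos p q by auto
  have close: "r powr \<alpha> / L - L \<le> 2 * B * k powr (1/q)"
    if "norm (f S - u) \<le> B * k powr (1/q)" "norm (f T - u) \<le> B * k powr (1/q)" "0 \<le> r" "r \<le> norm (S - T)"
    for S T u r and k :: nat
  proof -
    have "r powr \<alpha> \<le> norm (S - T) powr \<alpha>" using that pos by (intro powr_mono2) auto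
    then have "r powr \<alpha> / L - L \<le> norm (S - T) powr \<alpha> / L - L" using pos by (simp add: divide_right_mono)
    also have "\<dots> \<le> norm (f S - f T)" by (rule lower)
    also have "\<dots> \<le> norm (f S - u) + norm (f T - u)"
      using norm_triangle_ineq4[of "f S - u" "f T - u"] by simp
    finally show ?thesis using that by linarith
  qed
  obtain x :: "nat \<Rightarrow> 'a" where x: "\<And>n. norm (x n) = 1" and sep: "\<And>m n. m \<noteq> n \<Longrightarrow> 1/2 \<le> norm (x m - x n)"
    using separated_sequence[OF inf] by blast
  have "\<And>n. norm (x n) \<le> 1" using x by simp
  from weakly_Cauchy_or_alternating[of x 1, OF this] show ?thesis
  proof (elim disjE exE conjE)
    fix r :: "nat \<Rightarrow> nat" assume r: "strict_mono r"
      and wC: "\<forall>\<phi>::'a \<Rightarrow> real. bounded_linear \<phi> \<longrightarrow> convergent (\<lambda>n. \<phi> (x (r n)))"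
    \<comment> \<open>Differences of terms of a weakly Cauchy sequence are weakly null, and the
      separation keeps their norms at least \<open>1/2\<close>. Norms up to \<open>2\<close> explain
      the scale \<open>4 = 2 * 2\<close> in \<open>moves\<close>.\<close>
    define z where "z i = x (r (2 * i)) - x (r (2 * i + 1))" for i
    have z2: "norm (z i) \<le> 2" for i
      using norm_triangle_ineq4[of "x (r (2 * i))" "x (r (2 * i + 1))"] x by (simp add: z_def)
    have "r (2 * i) \<noteq> r (2 * i + 1)" for i using r by (simp add: strict_mono_eq)
    then have "1/2 \<le> norm (z i)" for i unfolding z_def by (rule sep)
    with z2 have semi: "semi_normalized z"
      unfolding semi_normalized_def by (intro exI[of _ "1/2"] exI[of _ 2]) auto
    have null: "weakly_null z"
      unfolding weakly_null_def
    proof (intro allI impI)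
      fix \<phi> :: "'a \<Rightarrow> real" assume \<phi>: "bounded_linear \<phi>"
      with wC obtain l where l: "(\<lambda>n. \<phi> (x (r n))) \<longlonglongrightarrow> l" unfolding convergent_def by blast
      have "(\<lambda>i. \<phi> (x (r (2 * i))) - \<phi> (x (r (2 * i + 1)))) \<longlonglongrightarrow> l - l"
        using LIMSEQ_subseq_LIMSEQ[OF l, of "\<lambda>i. 2 * i"] LIMSEQ_subseq_LIMSEQ[OF l, of "\<lambda>i. 2 * i + 1"]
        by (intro tendsto_diff) (auto simp: strict_mono_def o_def)
      then show "(\<lambda>n. \<phi> (z n)) \<longlonglongrightarrow> 0"
        using \<phi> by (simp add: z_def bounded_linear.linear linear_diff)
    qed
    obtain n \<theta> where n: "strict_mono (n::nat \<Rightarrow> nat)" and \<theta>1: "\<forall>j. 1 \<le> \<theta> j"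
      and \<theta>2: "\<forall>a>0. filterlim (\<lambda>j. real j powr a / \<theta> j) at_top sequentially"
      and big: "\<forall>k\<ge>1. \<forall>J. finite J \<and> card J = k \<and> (\<forall>j\<in>J. k \<le> j) \<longrightarrow>
        real k powr (1/p) / \<theta> k \<le> norm (\<Sum>j\<in>J. z (n j))"
      using BS[unfolded almost_co_BS_def, THEN spec, THEN mp, OF conjI[OF semi null]]
      by (elim exE conjE)
    note \<theta> = \<theta>1[rule_format] \<theta>2[rule_format]
    obtain U where U: "U \<noteq> bot" "U \<le> sequentially"
      and it: "\<And>k. \<exists>u. iter_eventually U (z \<circ> n) k (\<lambda>S. norm (f S - u) \<le> B * k powr (1/q)) 0"
      using conc[of "z \<circ> n"] z2 by auto
    show ?thesis
    proof (rule exponent_bound)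
      show "1 \<le> \<theta> j" for j by (rule \<theta>)
      show "filterlim (\<lambda>j. real j powr a / \<theta> j) at_top sequentially" if "a > 0" for a using that by (rule \<theta>)
      fix k :: nat assume k: "k \<ge> 1"
      obtain u where u: "iter_eventually U (z \<circ> n) k (\<lambda>S. norm (f S - u) \<le> B * k powr (1/q)) 0"
        using it by blast
      obtain J where J: "finite J" "card J = k" "\<forall>j\<in>J. k \<le> j"
        "norm (f (0 + (\<Sum>j\<in>J. (z \<circ> n) j)) - u) \<le> B * k powr (1/q)"
        \<comment> \<open>Starting the indices at \<open>k\<close> meets the requirement on
          \<open>J\<close> in the co-Banach-Saks property.\<close>
        using iter_eventually_select[OF U u, of k] by (elim exE conjE)
      define S where "S = (\<Sum>j\<in>J. z (n j))"
      have S: "norm (f S - u) \<le> B * k powr (1/q)" using J(4) by (simp add: S_def o_def)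
      have Sbig: "real k powr (1/p) / \<theta> k \<le> norm S" unfolding S_def using big k J(1-3) by blast
      have "0 < real k powr (1/p) / \<theta> k" using k \<theta>(1)[of k] by simp
      with Sbig have "norm S > 0" by linarith
      \<comment> \<open>The lower estimate holds for sums, not for differences. So \<open>T\<close>
        is chosen with \<open>\<phi> T \<le> norm S / 2\<close> for a norming functional of
        \<open>S\<close>, leaving at least half of \<open>norm S\<close> in
        \<open>S - T\<close>.\<close>
      obtain \<phi> where \<phi>: "bounded_linear \<phi>" "\<And>y. \<bar>\<phi> y\<bar> \<le> norm y" "\<phi> S = norm S"
        using norming_functional[of S] by blast
      have "(\<lambda>j. \<phi> (z j)) \<longlonglongrightarrow> 0" using null \<phi>(1) unfolding weakly_null_def by blast
      from LIMSEQ_subseq_LIMSEQ[OF this n] have "((\<lambda>j. \<phi> ((z \<circ> n) j)) \<longlongrightarrow> 0) U"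
        using U(2) by (auto simp: o_def intro: tendsto_mono)
      then obtain T where T: "norm (f T - u) \<le> B * k powr (1/q)" "\<bar>\<phi> T - \<phi> 0\<bar> \<le> k * (norm S / (2 * k))"
        using iter_eventually_functional_small[OF U(1) _ bounded_linear.linear[OF \<phi>(1)] _ u, of "norm S / (2 * k)"]
          \<open>norm S > 0\<close> k by auto
      have "\<phi> T \<le> norm S / 2"
        using T(2) k linear_0[OF bounded_linear.linear[OF \<phi>(1)]] by (simp add: field_simps)
      moreover have "\<phi> S - \<phi> T \<le> norm (S - T)"
        using \<phi>(2)[of "S - T"] linear_diff[OF bounded_linear.linear[OF \<phi>(1)], of S T] by simp
      ultimately have "1/2 * (k powr (1/p) / \<theta> k) \<le> norm (S - T)" using Sbig \<phi>(3) by linarith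
      then show "(1/2 * (k powr (1/p) / \<theta> k)) powr \<alpha> / L - L \<le> 2 * B * k powr (1/q)"
        using \<theta>(1)[of k] by (intro close[OF S T(1)]) auto
    qed (use pos p q B in auto)
  next
    fix \<delta> :: real assume \<delta>: "\<delta> > 0" and alt: "\<forall>k. \<exists>r::nat \<Rightarrow> nat. strict_mono r \<and>
       (\<forall>l. sorted_wrt (<) l \<and> length l = 2 * k \<longrightarrow> k * \<delta> \<le> norm (alternating_sum (x \<circ> r) l))"
    show ?thesis
    \<comment> \<open>Here \<open>\<theta>\<close> is constantly \<open>1\<close> and
      \<open>c = \<delta>\<close>: the alternating sums even grow linearly, and
      \<open>k powr (1/p) \<le> k\<close> as \<open>p > 1\<close>.\<close>
    proof (rule exponent_bound)
      show "1 \<le> (1::real)" by simp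
      show "filterlim (\<lambda>j. real j powr a / 1) at_top sequentially" if "a > 0" for a
        using filterlim_nat_powr_at_top[OF that] by simp
      fix k :: nat assume k: "k \<ge> 1"
      obtain r :: "nat \<Rightarrow> nat" where r: "strict_mono r"
        "\<And>l. sorted_wrt (<) l \<Longrightarrow> length l = 2 * k \<Longrightarrow> k * \<delta> \<le> norm (alternating_sum (x \<circ> r) l)"
        using alt by blast
      obtain U where U: "U \<noteq> bot" "U \<le> sequentially"
        and "\<forall>k. \<exists>u. iter_eventually U (x \<circ> r) k (\<lambda>S. norm (f S - u) \<le> B * k powr (1/q)) 0"
        using conc[of "x \<circ> r"] x by auto
      then obtain u where it: "iter_eventually U (x \<circ> r) k (\<lambda>S. norm (f S - u) \<le> B * k powr (1/q)) 0"
        by blast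
      obtain l S T where l: "length l = 2 * k" "sorted_wrt (<) l"
        and S: "norm (f S - u) \<le> B * k powr (1/q)" and T: "norm (f T - u) \<le> B * k powr (1/q)"
        and ST: "S - T = 0 - 0 + alternating_sum (x \<circ> r) l"
        using iter_eventually_interlaced[OF U it it, of 0] by (elim exE conjE)
      have "k powr (1/p) \<le> k powr 1" using k p by (intro powr_mono) auto
      then have "\<delta> * (k powr (1/p) / 1) \<le> k * \<delta>" using \<delta> k by simp
      also have "\<dots> \<le> norm (S - T)" using r(2)[OF l(2,1)] ST by simp
      finally show "(\<delta> * (k powr (1/p) / 1)) powr \<alpha> / L - L \<le> 2 * B * k powr (1/q)"
        using \<delta> by (intro close[OF S T]) auto
    qed (use pos p q B \<delta> in auto)
  qed
qed

lemma expansion_modulus_finite_imp_uniformly_moves: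
  assumes "expansion_modulus f t < \<infinity>"
  shows "\<exists>D>0. uniformly_moves t D f"
proof -
  obtain M where M: "expansion_modulus f t \<le> ereal M"
    using assms by (cases "expansion_modulus f t") auto
  have "norm (f x - f y) \<le> max M 1" if "norm (x - y) \<le> t" for x y
  proof -
    have "ereal (norm (f (fst (x, y)) - f (snd (x, y)))) \<le> expansion_modulus f t"
      unfolding expansion_modulus_def by (rule SUP_upper) (use that in simp)
    also note M
    finally show ?thesis by simp
  qed
  then show ?thesis unfolding uniformly_moves_def by (intro exI[of _ "max M 1"]) auto
qed

theorem theorem4p5:
  fixes p q :: real
  assumes "1 < p" and "p < q"
    and "infinite_dimensional TYPE('a::banach)"
    and "almost_co_BS p TYPE('a)"
    and "reflexive TYPE('b::banach)"
    and "asymptotically_uniformly_smooth q TYPE('b)"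
  shows "compression_exponent TYPE('b) TYPE('a) \<le> ereal (p / q)
         \<and> \<not> (\<exists>f :: 'a \<Rightarrow> 'b. coarse_lipschitz_embedding f)"
proof
  have "\<alpha> \<le> p / q" if \<alpha>: "\<alpha> \<in> compression_exponents TYPE('a) TYPE('b)" for \<alpha>
  proof -
    obtain f :: "'a \<Rightarrow> 'b" and L where f: "coarse_embedding f" and L: "L > 0" "\<alpha> > 0"
      and lower: "\<And>x y. norm (f x - f y) \<ge> norm (x - y) powr \<alpha> / L - L"
      using \<alpha> unfolding compression_exponents_def by blast
    have "expansion_modulus f 4 < \<infinity>" using f unfolding coarse_embedding_def by simp
    then obtain D where "D > 0" "uniformly_moves 4 D f"
      using expansion_modulus_finite_imp_uniformly_moves by blast
    then show ?thesis using compression_le[OF assms _ _ L lower] by blast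
  qed
  then show "compression_exponent TYPE('b) TYPE('a) \<le> ereal (p / q)"
    \<comment> \<open>If no exponent is admissible, the value is \<open>0\<close>, and
      \<open>p / q\<close> is positive.\<close>
    using assms(1,2) unfolding compression_exponent_def by (auto intro: Sup_least)
next
  show "\<not> (\<exists>f :: 'a \<Rightarrow> 'b. coarse_lipschitz_embedding f)"
  proof
    assume "\<exists>f :: 'a \<Rightarrow> 'b. coarse_lipschitz_embedding f"
    then obtain f :: "'a \<Rightarrow> 'b" and L where L: "L > 0"
      and up: "\<And>t. t \<ge> 0 \<Longrightarrow> expansion_modulus f t \<le> ereal (L * t + L)"
      and down: "\<And>t. t \<ge> 0 \<Longrightarrow> compression_modulus f t \<ge> ereal (t / L - L)"
      unfolding coarse_lipschitz_embedding_def by blast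
    have "expansion_modulus f 4 < \<infinity>" by (rule le_less_trans[OF up[of 4]]) auto
    then obtain D where D: "D > 0" "uniformly_moves 4 D f"
      using expansion_modulus_finite_imp_uniformly_moves by blast
    have "norm (x - y) powr 1 / L - L \<le> norm (f x - f y)" for x y
    proof -
      have "ereal (norm (x - y) / L - L) \<le> compression_modulus f (norm (x - y))" by (rule down) simp
      also have "\<dots> \<le> ereal (norm (f (fst (x, y)) - f (snd (x, y))))"
        unfolding compression_modulus_def by (rule INF_lower) simp
      finally show ?thesis by simp
    qed
    \<comment> \<open>Exponent \<open>1\<close> would give \<open>1 \<le> p / q\<close>, against
      \<open>p < q\<close>.\<close>
    from compression_le[OF assms D(2,1) L zero_less_one this] assms(1,2) show False by simp
  qed
qed

end
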